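(* Consider a kinetic-energy-preserving space-time DGSEM solution $\{\mathbf U^{n,k}\}_{1\le n\le K_T,\,1\le k\le K_S}$ for the three-dimensional compressible Euler equations (as defined in the context) with: 1. Dirichlet boundary conditions in time, given by initial nodal data $\mathbf u^{1,k}_{ijk}=\mathbf u^k(0)_{ijk}$, and periodic boundary conditions in space; 2. temporal numerical states $\mathbf U^{*}$ (one single-valued state at each temporal interface, used by both adjacent elements) with $\mathbf U^{1,k,*}|_{\tau=-1}=\mathbf u^{1,k}$ and $\mathbf U^{K_T,k,*}|_{\tau=1}=\mathbf U^{K_T,k}|_{\tau=1}$ at the exterior temporal boundary points, and, at the interior temporal interfaces, $\mathbf U^*_{1+m}=\{\!\{v_m\}\!\}\,\mathbf U^*_1$ for $m=1,2,3$; 3. spatial surface fluxes $\tilde{\mathbf F}^*_{\hat n}=\hat s\left(n_1\mathbf F_1^{KEP}+n_2\mathbf F_2^{KEP}+n_3\mathbf F_3^{KEP}\right)$ computed from Cartesian two-point fluxes $\mathbf F_s^{KEP}$, $s=1,2,3$, evaluated at the two states on either side of the interface, whose components satisfy $$\mathbf F_s^{1+m,KEP}=\{\!\{v_m\}\!\}\,\mathbf F_s^{1,KEP}+\delta_{ms}\{\!\{p\}\!\},\qquad s,m=1,2,3.$$ Then the method is kinetic energy preserving in the sense that $$\begin{aligned}\bar K(\mathbf U(T))=\;&\bar K(\mathbf u(0))+\sum_{n=1}^{K_T}\sum_{k=1}^{K_S}\frac{\Delta t^n}{2}\Big\langle\nabla_\xi\cdot\mathbb I^N(\tilde{v}^{\,n,k}),p^{n,k}\Big\rangle_{N\times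 M}\\&+\sum_{n=1}^{K_T}\sum_{\text{interior faces}}\frac{\Delta t^n}{2}\int_{N}\Big\langle\{\!\{p^{n,k}\}\!\}[\![\tilde v^{\,n,k}_{\hat n}]\!],1\Big\rangle_M dS+\sum_{k=1}^{K_S}\Big\langle[\![\mathbf V^{1,k}]\!]^T\mathbf u^{1,k},J^k\Big\rangle_N\Big|_{\tau=-1},\end{aligned}$$ where $\int_N$ denotes discrete integration over the respective face and $$\bar K(\mathbf U(T))=\sum_{k=1}^{K_S}\big\langle\kappa(\mathbf U^{K_T,k}),J^k\big\rangle_N\big|_{\tau=1},\qquad \bar K(\mathbf u(0))=\sum_{k=1}^{K_S}\big\langle\kappa(\mathbf u^{1,k}),J^k\big\rangle_N\big|_{\tau=-1}.$$
   Context: **Euler equations.** $\partial_t\mathbf u+\sum_{i=1}^3\partial_{x_i}\mathbf f_i(\mathbf u)=0$, with $\mathbf u=(\rho,\rho v_1,\rho v_2,\rho v_3,E)^T$, $p=(\gamma-1)(E-\frac\rho2|\vec v|^2)$ and $\mathbf f_i=(\rho v_i,\ \rho v_iv_1+\delta_{i1}p,\ \rho v_iv_2+\delta_{i2}p,\ \rho v_iv_3+\delta_{i3}p,\ (E+p)v_i)^T$. Densities are positive. The kinetic energy is $\kappa(\mathbf u)=\frac12\rho|\vec v|^2$. The kinetic energy variables are $\mathbf V=\mathbf V(\mathbf u)=(-\frac12|\vec v|^2,v_1,v_2,v_3,0)^T=\partial\kappa/\partial\mathbf u$. **Mesh.** $[0,T]$ is divided into intervals $I_n$ of length $\Delta t^n$,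 $n=1,\dots,K_T$, each mapped affinely to $\tau\in[-1,1]$. The spatial domain is divided into $K_S$ conforming (possibly curved) hexahedral elements $e_k$, each the image of $E^3=[-1,1]^3$ (coordinates $\xi^1,\xi^2,\xi^3$) under a mapping $\vec\chi=(X_1,X_2,X_3)$. $J$ denotes the nodal values of the polynomial approximation of the Jacobian determinant (positive, time independent). The discrete contravariant vectors $J\vec a^{\,l}=(Ja^l_1,Ja^l_2,Ja^l_3)$, $l=1,2,3$, are $Ja^l_\alpha=-\big[\nabla_\xi\times \mathbb I^N(X_\gamma\nabla_\xi X_\beta)\big]_l$ ($l$-th component of the curl, $(\alpha,\beta,\gamma)$ cyclic), and hence satisfy the discrete metric identities $\sum_{l=1}^3\partial_{\xi^l}\mathbb I^N(Ja^l_m)=0$, $m=1,2,3$. On a face of $E^3$ with outward reference unit normal $\hat n=(\hat n^1,\hat n^2,\hat n^3)$, the scaled physical normal is $\hat s\vec n=\sum_l \hat n^l J\vec a^{\,l}$, with $\hat s=|\sum_l\hat n^lJ\vec a^{\,l}|$. At each interface the face nodes of the two adjacent elements coincide and $\hat s\vec n$ agrees up to sign. With periodic boundary conditions opposite boundary faces are identified, so every face is counted as an interior face (once). **Nodes and operators.** Interpolation and quadrature use the Legendre-Gauss-Lobatto (LGL) nodes on $[-1,1]$: $M+1$ nodes $\tau_\sigma$ in time and $N+1$ nodes in each spatial direction, with LGL weights $\omega$ of the respective rule. $\mathcal D_{ij}=\ell_j'(\xi_i)$ is the derivative matrix of the Lagrange basis at the LGL nodes (of degree $M$ in time, $N$ in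 space). A function with nodal values $\mathbf U_{\sigma ijk}$ ($\sigma=0,\dots,M$; $i,j,k=0,\dots,N$) is a polynomial of degree $M$ in $\tau$ and of tensor degree $N$ in space; $\mathbb I^N$ is spatial tensor LGL interpolation. $\mathbf V^{n,k}$, $p^{n,k}$, $\vec v^{\,n,k}$ are given by the nodal values computed from $\mathbf U^{n,k}$. Write $\omega_{ijk}=\omega_i\omega_j\omega_k$ and $\langle\mathbf F,\mathbf G\rangle_{N\times M}=\sum_{\sigma,i,j,k}\omega_\sigma\omega_{ijk}\mathbf F_{\sigma ijk}^T\mathbf G_{\sigma ijk}$. Write $\langle\mathbf F,\mathbf G\rangle_N|_{\tau=1}=\sum_{ijk}\omega_{ijk}\mathbf F_{Mijk}^T\mathbf G_{Mijk}$, $\langle\mathbf F,\mathbf G\rangle_N|_{\tau=-1}=\sum_{ijk}\omega_{ijk}\mathbf F_{0ijk}^T\mathbf G_{0ijk}$, and $\langle\cdot,\cdot\rangle_N|_{-1}^{1}$ for their difference (quantities without time index, such as $J^k$ or $\mathbf u^{1,k}$, enter through their spatial nodal values). $\int_{\partial E^3,N}\langle g,1\rangle_M\,dS$ is the sum over the six faces of $E^3$, the face LGL nodes and the time nodes $\sigma$ of $g$ times the product of the two face weights and $\omega_\sigma$; for a single face, $\int_N\langle g,1\rangle_MdS$ is the corresponding sum over that face only. The contravariant velocity is $\tilde v=(\tilde v^1,\tilde v^2,\tilde v^3)$, $\tilde v^l=\vec v\cdot J\vec a^{\,l}$, and $\tilde v_{\hat n}=\hat s\,\vec n\cdot\vec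 v$. **Temporal volume two-point state.** $\mathbf U^{KEP}(\cdot,\cdot)$ is consistent ($\mathbf U^{KEP}(\mathbf a,\mathbf a)=\mathbf a$), symmetric, and satisfies $\mathbf U^{KEP}_{1+m}=\{\!\{v_m\}\!\}\mathbf U^{KEP}_1$, $m=1,2,3$ ($\{\!\{\cdot\}\!\}$ is the arithmetic mean over the two argument states). Put $(\mathbb D^M\mathbf U^{KEP})_{\sigma ijk}=2\sum_{\theta=0}^M\mathcal D_{\sigma\theta}\mathbf U^{KEP}(\mathbf U_{\sigma ijk},\mathbf U_{\theta ijk})$. **Spatial volume fluxes.** For each reference direction $l=1,2,3$, two-point fluxes $\mathbf F_s^{KEP,l}$, $s=1,2,3$, are consistent with $\mathbf f_s$, symmetric in the two nodes, and satisfy $$\mathbf F_s^{1+m,KEP,l}=\{\!\{v_m\}\!\}\mathbf F_s^{1,KEP,l}+\delta_{ms}\,p^\star_{sl},\qquad p^\star_{sl}=2\{\!\{p\}\!\}-\frac{\{\!\{p\,Ja^l_s\}\!\}}{\{\!\{Ja^l_s\}\!\}},\qquad s,m=1,2,3,$$ where the first superscript numbers the components of the flux vector and all means are over the two nodes involved. In the operator below the product $p^\star_{sl}\{\!\{Ja^l_s\}\!\}$ is always read as $2\{\!\{p\}\!\}\{\!\{Ja^l_s\}\!\}-\{\!\{p\,Ja^l_s\}\!\}$. Put $$(\mathbb D^N\!\cdot\tilde{\mathbf F}^{KEP})_{\sigma ijk}=2\sum_{m=0}^N\sum_{s=1}^3\Big[\mathcal D_{im}\mathbf F_s^{KEP,1}(\mathbf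 U_{\sigma ijk},\mathbf U_{\sigma mjk})\{\!\{Ja^1_s\}\!\}_{(i,m)jk}+\mathcal D_{jm}\mathbf F_s^{KEP,2}(\mathbf U_{\sigma ijk},\mathbf U_{\sigma imk})\{\!\{Ja^2_s\}\!\}_{i(j,m)k}+\mathcal D_{km}\mathbf F_s^{KEP,3}(\mathbf U_{\sigma ijk},\mathbf U_{\sigma ijm})\{\!\{Ja^3_s\}\!\}_{ij(k,m)}\Big],$$ where e.g. $\{\!\{\cdot\}\!\}_{(i,m)jk}=\frac12[(\cdot)_{ijk}+(\cdot)_{mjk}]$. The surface fluxes $\mathbf F_s^{KEP}$ are consistent and symmetric two-point fluxes. **Scheme.** A solution is a family $\mathbf U^{n,k}$ of such polynomials with, for every $(n,k)$ and every vector-valued polynomial test function $\boldsymbol\varphi$ (degree $M$ in time, tensor degree $N$ in space), $A_T(\mathbf U,\boldsymbol\varphi)+A_S(\mathbf F,\boldsymbol\varphi)=0$, where (superscripts $n,k$ suppressed) $$A_T(\mathbf U,\boldsymbol\varphi)=\langle J\,\mathbb D^M\mathbf U^{KEP},\boldsymbol\varphi\rangle_{N\times M}+\langle J(\mathbf U^*-\mathbf U),\boldsymbol\varphi\rangle_N\big|_{-1}^{1},$$ $$A_S(\mathbf F,\boldsymbol\varphi)=\frac{\Delta t}{2}\langle\mathbb D^N\!\cdot\tilde{\mathbf F}^{KEP},\boldsymbol\varphi\rangle_{N\times M}+\frac{\Delta t}{2}\int_{\partial E^3,N}\langle\boldsymbol\varphi^T(\tilde{\mathbf F}^*_{\hat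 n}-\tilde{\mathbf F}_{\hat n}),1\rangle_M\,dS,$$ with $\tilde{\mathbf F}_{\hat n}=\hat s\sum_m n_m\mathbf f_m(\mathbf U)$ and $\vec n$ pointing out of the element. **Jumps and means.** $[\![\cdot]\!]=(\cdot)_+-(\cdot)_-$ and $\{\!\{\cdot\}\!\}=\frac12((\cdot)_++(\cdot)_-)$. At the temporal interface $\tau=-1$ of element $(n,k)$, $+$ denotes the value in element $(n,k)$ at $\tau=-1$ and $-$ the value in element $(n-1,k)$ at $\tau=1$ (for $n=1$: the initial data $\mathbf u^{1,k}$). At a spatial interior face, $\vec n$ is the unique normal pointing from the $-$ to the $+$ side and $[\![\tilde v_{\hat n}]\!]=\hat s\,\vec n\cdot[\![\vec v]\!]$. *)

theory Defs
  imports "HOL-Analysis.Analysis" "HOL-Computational_Algebra.Polynomial"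
begin

text \<open>A state \<open>(\<rho>, \<rho> v, E)\<close> in five-dimensional space, with the three momentum components grouped;
  \<open>u \<bullet> w\<close> on this product type is the Euclidean inner product of the five components.\<close>

type_synonym state = "real \<times> (real^3) \<times> real"

definition dens :: "state \<Rightarrow> real" where "dens u = fst u"
definition mom :: "state \<Rightarrow> real^3" where "mom u = fst (snd u)"
definition energy :: "state \<Rightarrow> real" where "energy u = snd (snd u)"
definition vel :: "state \<Rightarrow> real^3" where "vel u = (1 / dens u) *\<^sub>R mom u"

definition pres :: "real \<Rightarrow> state \<Rightarrow> real" where
  "pres \<gamma> u = (\<gamma> - 1) * (energy u - dens u / 2 * (norm (vel u))\<^sup>2)"

definition euler_flux :: "real \<Rightarrow> 3 \<Rightarrow> state \<Rightarrow> state" where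
  "euler_flux \<gamma> i u =
    (dens u * vel u $ i,
     (\<chi> m. dens u * vel u $ i * vel u $ m + (if m = i then pres \<gamma> u else 0)),
     (energy u + pres \<gamma> u) * vel u $ i)"

definition kin :: "state \<Rightarrow> real" where
  "kin u = 1/2 * dens u * (norm (vel u))\<^sup>2"

definition kev :: "state \<Rightarrow> state" where
  "kev u = (- (1/2) * (norm (vel u))\<^sup>2, vel u, 0)"

definition mean :: "'a::real_vector \<Rightarrow> 'a \<Rightarrow> 'a" where
  "mean a b = (1/2) *\<^sub>R (a + b)"

text \<open>Rodrigues' formula.\<close>
definition legendre :: "nat \<Rightarrow> real poly" where
  "legendre n = smult (1 / (2 ^ n * fact n)) ((pderiv ^^ n) ([:-1, 0, 1:] ^ n))"

text \<open>For \<open>N \<ge> 1\<close> the polynomial \<open>(1 - x^2) P_N'(x)\<close> has exactly \<open>N + 1\<close> real zeros, listed here in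
  increasing order with index \<open>0, \<dots>, N\<close>.\<close>
definition lgl_node :: "nat \<Rightarrow> nat \<Rightarrow> real" where
  "lgl_node N i =
    sorted_list_of_set {x. poly ([:1, 0, -1:] * pderiv (legendre N)) x = 0} ! i"

definition lagrange :: "nat \<Rightarrow> nat \<Rightarrow> real poly" where
  "lagrange N j =
    (\<Prod>i\<in>{..N} - {j}. smult (1 / (lgl_node N j - lgl_node N i)) [:- lgl_node N i, 1:])"

definition lgl_weight :: "nat \<Rightarrow> nat \<Rightarrow> real" where
  "lgl_weight N i = integral {-1..1} (poly (lagrange N i))"

definition dmat :: "nat \<Rightarrow> nat \<Rightarrow> nat \<Rightarrow> real" where
  "dmat N i j = poly (pderiv (lagrange N j)) (lgl_node N i)"

text \<open>A spatial node \<open>(i,j,k)\<close> is an index function on the three reference directions, so that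
  \<open>\<nu>(l := m)\<close> replaces the \<open>l\<close>-th index. In type \<^typ>\<open>3\<close> arithmetic is modulo \<open>3\<close> (and \<open>3 = 0\<close>):
  \<open>(\<alpha>, \<alpha> + 1, \<alpha> + 2)\<close> is a cyclic triple.\<close>
type_synonym node = "3 \<Rightarrow> nat"

definition nodes :: "nat \<Rightarrow> node set" where
  "nodes N = {\<nu>. \<forall>l. \<nu> l \<le> N}"

definition pt :: "nat \<Rightarrow> node \<Rightarrow> real^3" where
  "pt N \<nu> = (\<chi> l. lgl_node N (\<nu> l))"

definition wt :: "nat \<Rightarrow> node \<Rightarrow> real" where
  "wt N \<nu> = (\<Prod>l\<in>UNIV. lgl_weight N (\<nu> l))"

definition ref_cube :: "(real^3) set" where
  "ref_cube = cbox (vec (-1)) (vec 1)"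

definition interp :: "nat \<Rightarrow> (node \<Rightarrow> real) \<Rightarrow> real^3 \<Rightarrow> real" where
  "interp N f x = (\<Sum>\<nu>\<in>nodes N. f \<nu> * (\<Prod>l\<in>UNIV. poly (lagrange N (\<nu> l)) (x $ l)))"

text \<open>The derivative is taken within the cube since element mappings matter only there.\<close>
definition partial :: "3 \<Rightarrow> (real^3 \<Rightarrow> real) \<Rightarrow> real^3 \<Rightarrow> real" where
  "partial l g x = frechet_derivative g (at x within ref_cube) (axis l 1)"

text \<open>The face \<open>(l, b)\<close> is \<open>\<xi>^l = 1\<close> if \<open>b\<close> and \<open>\<xi>^l = -1\<close> otherwise.\<close>
type_synonym face = "3 \<times> bool"

definition ref_normal :: "face \<Rightarrow> real^3" where
  "ref_normal f = axis (fst f) (if snd f then 1 else -1)"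

definition ref_face :: "face \<Rightarrow> (real^3) set" where
  "ref_face f = {x \<in> ref_cube. x $ fst f = (if snd f then 1 else -1)}"

definition face_nodes :: "nat \<Rightarrow> face \<Rightarrow> node set" where
  "face_nodes N f = {\<nu> \<in> nodes N. \<nu> (fst f) = (if snd f then N else 0)}"

definition face_wt :: "nat \<Rightarrow> face \<Rightarrow> node \<Rightarrow> real" where
  "face_wt N f \<nu> = (\<Prod>j\<in>UNIV - {fst f}. lgl_weight N (\<nu> j))"

text \<open>Grid functions carry the time index (if any) first, then the spatial node.\<close>

definition ip_space :: "nat \<Rightarrow> (node \<Rightarrow> 'a::real_inner) \<Rightarrow> (node \<Rightarrow> 'a) \<Rightarrow> real" where
  "ip_space N F G = (\<Sum>\<nu>\<in>nodes N. wt N \<nu> * (F \<nu> \<bullet> G \<nu>))"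

definition ip_spacetime ::
  "nat \<Rightarrow> nat \<Rightarrow> (nat \<Rightarrow> node \<Rightarrow> 'a::real_inner) \<Rightarrow> (nat \<Rightarrow> node \<Rightarrow> 'a) \<Rightarrow> real" where
  "ip_spacetime N M F G =
    (\<Sum>\<sigma>\<le>M. \<Sum>\<nu>\<in>nodes N. lgl_weight M \<sigma> * wt N \<nu> * (F \<sigma> \<nu> \<bullet> G \<sigma> \<nu>))"

definition face_integral :: "nat \<Rightarrow> nat \<Rightarrow> face \<Rightarrow> (nat \<Rightarrow> node \<Rightarrow> real) \<Rightarrow> real" where
  "face_integral N M f g =
    (\<Sum>\<nu>\<in>face_nodes N f. \<Sum>\<sigma>\<le>M. face_wt N f \<nu> * lgl_weight M \<sigma> * g \<sigma> \<nu>)"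

definition jac :: "nat \<Rightarrow> (real^3 \<Rightarrow> real^3) \<Rightarrow> node \<Rightarrow> real" where
  "jac N X \<nu> = det (\<chi> \<alpha> l. partial l (\<lambda>x. X x $ \<alpha>) (pt N \<nu>))"

text \<open>\<open>metric N X \<nu> $ l $ \<alpha>\<close> is the nodal value of \<open>Ja^l_\<alpha>\<close>, minus the \<open>l\<close>-th component of the curl of
  the interpolant of \<open>X_\<gamma> \<nabla>X_\<beta>\<close> with \<open>\<beta> = \<alpha> + 1\<close>, \<open>\<gamma> = \<alpha> + 2\<close>.\<close>
definition metric :: "nat \<Rightarrow> (real^3 \<Rightarrow> real^3) \<Rightarrow> node \<Rightarrow> real^3^3" where
  "metric N X \<nu> = (\<chi> l \<alpha>.
    let G = (\<lambda>j. interp N (\<lambda>\<mu>. X (pt N \<mu>) $ (\<alpha> + 2) *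
                               partial j (\<lambda>x. X x $ (\<alpha> + 1)) (pt N \<mu>)))
    in - (partial (l + 1) (G (l + 2)) (pt N \<nu>) - partial (l + 2) (G (l + 1)) (pt N \<nu>)))"

text \<open>The outward scaled normal, i.e. the product of \<open>s\<close> and the unit normal \<open>n\<close>.\<close>
definition scaled_normal :: "nat \<Rightarrow> (real^3 \<Rightarrow> real^3) \<Rightarrow> face \<Rightarrow> node \<Rightarrow> real^3" where
  "scaled_normal N X f \<nu> = (\<Sum>l\<in>UNIV. ref_normal f $ l *\<^sub>R metric N X \<nu> $ l)"

definition contra_vel :: "nat \<Rightarrow> (real^3 \<Rightarrow> real^3) \<Rightarrow> (node \<Rightarrow> state) \<Rightarrow> 3 \<Rightarrow> node \<Rightarrow> real" where
  "contra_vel N X u l \<nu> = vel (u \<nu>) \<bullet> metric N X \<nu> $ l"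

text \<open>Nodal values of the divergence of the interpolated contravariant velocity.\<close>
definition div_contra_vel :: "nat \<Rightarrow> (real^3 \<Rightarrow> real^3) \<Rightarrow> (node \<Rightarrow> state) \<Rightarrow> node \<Rightarrow> real" where
  "div_contra_vel N X u \<nu> = (\<Sum>l\<in>UNIV. partial l (interp N (contra_vel N X u l)) (pt N \<nu>))"

text \<open>Elements are numbered \<open>1, \<dots>, num_elems\<close>. A face of element \<open>k\<close> is a pair \<open>(k, f)\<close>. It is
  identified with the face \<open>nbr (k, f)\<close>, its node \<open>\<nu>\<close> with the node \<open>glue (k, f) \<nu>\<close> there, and the
  two physical points differ by \<open>offset (k, f)\<close>, which is zero unless the face lies on the boundary
  of the domain and is identified periodically. Of the two sides of each interface exactly one is
  selected in \<open>minus_sides\<close>: it plays the role of the minus side, the other one that of the plus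
  side, and \<open>minus_sides\<close> thus enumerates every interface once.\<close>
record hex_mesh =
  num_elems :: nat
  chart :: "nat \<Rightarrow> real^3 \<Rightarrow> real^3"
  nbr :: "nat \<times> face \<Rightarrow> nat \<times> face"
  glue :: "nat \<times> face \<Rightarrow> node \<Rightarrow> node"
  offset :: "nat \<times> face \<Rightarrow> real^3"
  minus_sides :: "(nat \<times> face) set"

definition elem_faces :: "hex_mesh \<Rightarrow> (nat \<times> face) set" where
  "elem_faces \<M> = {1..num_elems \<M>} \<times> UNIV"

definition domain :: "hex_mesh \<Rightarrow> (real^3) set" where
  "domain \<M> = (\<Union>k\<in>{1..num_elems \<M>}. chart \<M> k ` ref_cube)"

text \<open>A node identification between two faces induced by one of the eight symmetries of the square:
  the two tangential directions are matched by \<open>\<pi>\<close>, each possibly with reversed orientation.\<close>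
definition square_symmetry :: "nat \<Rightarrow> face \<Rightarrow> face \<Rightarrow> (node \<Rightarrow> node) \<Rightarrow> bool" where
  "square_symmetry N f f' g \<longleftrightarrow>
    (\<exists>\<pi> rev. bij_betw \<pi> (UNIV - {fst f}) (UNIV - {fst f'}) \<and>
      (\<forall>\<nu>\<in>face_nodes N f. g \<nu> \<in> face_nodes N f' \<and>
        (\<forall>j\<in>UNIV - {fst f}. g \<nu> (\<pi> j) = (if rev j then N - \<nu> j else \<nu> j))))"

definition interface_ok :: "nat \<Rightarrow> hex_mesh \<Rightarrow> nat \<times> face \<Rightarrow> bool" where
  "interface_ok N \<M> F \<longleftrightarrow>
    (let k = fst F; f = snd F; k' = fst (nbr \<M> F); f' = snd (nbr \<M> F) in
      nbr \<M> F \<in> elem_faces \<M> \<and> nbr \<M> (nbr \<M> F) = F \<and>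
      (F \<in> minus_sides \<M>) \<noteq> (nbr \<M> F \<in> minus_sides \<M>) \<and>
      offset \<M> (nbr \<M> F) = - offset \<M> F \<and>
      (offset \<M> F \<noteq> 0 \<longrightarrow> chart \<M> k ` ref_face f \<subseteq> frontier (domain \<M>)) \<and>
      chart \<M> k' ` ref_face f' = (\<lambda>x. x + offset \<M> F) ` chart \<M> k ` ref_face f \<and>
      square_symmetry N f f' (glue \<M> F) \<and>
      (\<forall>\<nu>\<in>face_nodes N f.
        glue \<M> (nbr \<M> F) (glue \<M> F \<nu>) = \<nu> \<and>
        chart \<M> k' (pt N (glue \<M> F \<nu>)) = chart \<M> k (pt N \<nu>) + offset \<M> F \<and>
        scaled_normal N (chart \<M> k') f' (glue \<M> F \<nu>) = - scaled_normal N (chart \<M> k) f \<nu>))"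

definition periodic_mesh :: "nat \<Rightarrow> hex_mesh \<Rightarrow> bool" where
  "periodic_mesh N \<M> \<longleftrightarrow>
    1 \<le> num_elems \<M> \<and>
    (\<forall>k\<in>{1..num_elems \<M>}. chart \<M> k differentiable_on ref_cube \<and>
      (\<forall>\<nu>\<in>nodes N. 0 < jac N (chart \<M> k) \<nu>)) \<and>
    (\<forall>k\<in>{1..num_elems \<M>}. \<forall>k'\<in>{1..num_elems \<M>}. k \<noteq> k' \<longrightarrow>
      chart \<M> k ` interior ref_cube \<inter> chart \<M> k' ` interior ref_cube = {}) \<and>
    minus_sides \<M> \<subseteq> elem_faces \<M> \<and>
    (\<forall>F\<in>elem_faces \<M>. interface_ok N \<M> F)"

definition kep_time_state :: "(state \<Rightarrow> state \<Rightarrow> state) \<Rightarrow> bool" where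
  "kep_time_state UK \<longleftrightarrow>
    (\<forall>a. 0 < dens a \<longrightarrow> UK a a = a) \<and>
    (\<forall>a b. 0 < dens a \<longrightarrow> 0 < dens b \<longrightarrow>
      UK a b = UK b a \<and>
      (\<forall>m. mom (UK a b) $ m = mean (vel a $ m) (vel b $ m) * dens (UK a b)))"

text \<open>The volume fluxes also depend on the metric terms at the two nodes, so their arguments are
  pairs of a state and the matrix of contravariant vectors; the first index is the reference
  direction \<open>l\<close>, the second the Cartesian direction \<open>s\<close>.\<close>
type_synonym volume_flux = "3 \<Rightarrow> 3 \<Rightarrow> state \<times> (real^3^3) \<Rightarrow> state \<times> (real^3^3) \<Rightarrow> state"

definition pstar :: "real \<Rightarrow> 3 \<Rightarrow> 3 \<Rightarrow> state \<times> (real^3^3) \<Rightarrow> state \<times> (real^3^3) \<Rightarrow> real" where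
  "pstar \<gamma> l s x y =
    2 * mean (pres \<gamma> (fst x)) (pres \<gamma> (fst y))
    - mean (pres \<gamma> (fst x) * snd x $ l $ s) (pres \<gamma> (fst y) * snd y $ l $ s)
      / mean (snd x $ l $ s) (snd y $ l $ s)"

text \<open>If the mean metric term vanishes, the quotient in \<^const>\<open>pstar\<close> is meaningless, and the
  condition on the one component that contains it is not imposed (imposing it with \<open>x / 0 = 0\<close>
  would contradict consistency already on Cartesian meshes). See \<open>vol_product\<close> for this case.\<close>
definition kep_volume_flux :: "real \<Rightarrow> volume_flux \<Rightarrow> bool" where
  "kep_volume_flux \<gamma> FV \<longleftrightarrow>
    (\<forall>l s x. 0 < dens (fst x) \<longrightarrow> FV l s x x = euler_flux \<gamma> s (fst x)) \<and>
    (\<forall>l s x y. 0 < dens (fst x) \<longrightarrow> 0 < dens (fst y) \<longrightarrow>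
      FV l s x y = FV l s y x \<and>
      (\<forall>m. m \<noteq> s \<or> mean (snd x $ l $ s) (snd y $ l $ s) \<noteq> 0 \<longrightarrow>
        mom (FV l s x y) $ m =
          mean (vel (fst x) $ m) (vel (fst y) $ m) * dens (FV l s x y)
          + (if m = s then pstar \<gamma> l s x y else 0)))"

definition kep_surface_flux :: "real \<Rightarrow> (3 \<Rightarrow> state \<Rightarrow> state \<Rightarrow> state) \<Rightarrow> bool" where
  "kep_surface_flux \<gamma> FS \<longleftrightarrow>
    (\<forall>s a. 0 < dens a \<longrightarrow> FS s a a = euler_flux \<gamma> s a) \<and>
    (\<forall>s a b. 0 < dens a \<longrightarrow> 0 < dens b \<longrightarrow>
      FS s a b = FS s b a \<and>
      (\<forall>m. mom (FS s a b) $ m =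
        mean (vel a $ m) (vel b $ m) * dens (FS s a b)
        + (if m = s then mean (pres \<gamma> a) (pres \<gamma> b) else 0)))"

definition time_deriv ::
  "nat \<Rightarrow> (state \<Rightarrow> state \<Rightarrow> state) \<Rightarrow> (nat \<Rightarrow> node \<Rightarrow> state) \<Rightarrow> nat \<Rightarrow> node \<Rightarrow> state" where
  "time_deriv M UK u \<sigma> \<nu> = 2 *\<^sub>R (\<Sum>\<theta>\<le>M. dmat M \<sigma> \<theta> *\<^sub>R UK (u \<sigma> \<nu>) (u \<theta> \<nu>))"

text \<open>The product of the volume flux with the mean metric term. If the latter vanishes, all that
  remains is the product of the pressure term \<^const>\<open>pstar\<close> with the mean metric term, which is read
  as the expression obtained by cancelling the denominator.\<close>
definition vol_product ::
  "real \<Rightarrow> volume_flux \<Rightarrow> 3 \<Rightarrow> 3 \<Rightarrow> state \<times> (real^3^3) \<Rightarrow> state \<times> (real^3^3) \<Rightarrow> state" where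
  "vol_product \<gamma> FV l s x y =
    (let a = mean (snd x $ l $ s) (snd y $ l $ s) in
      if a \<noteq> 0 then a *\<^sub>R FV l s x y
      else (0,
            axis s (2 * mean (pres \<gamma> (fst x)) (pres \<gamma> (fst y)) * a
              - mean (pres \<gamma> (fst x) * snd x $ l $ s) (pres \<gamma> (fst y) * snd y $ l $ s)),
            0))"

definition space_div ::
  "real \<Rightarrow> nat \<Rightarrow> (real^3 \<Rightarrow> real^3) \<Rightarrow> volume_flux \<Rightarrow> (node \<Rightarrow> state) \<Rightarrow> node \<Rightarrow> state" where
  "space_div \<gamma> N X FV u \<nu> =
    2 *\<^sub>R (\<Sum>m\<le>N. \<Sum>s\<in>UNIV. \<Sum>l\<in>UNIV. dmat N (\<nu> l) m *\<^sub>R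
      vol_product \<gamma> FV l s (u \<nu>, metric N X \<nu>)
        (u (\<nu>(l := m)), metric N X (\<nu>(l := m))))"

text \<open>\<open>uL\<close> and \<open>uR\<close> are the temporal numerical states at \<open>\<tau> = -1\<close> and \<open>\<tau> = 1\<close>.\<close>
definition A_T ::
  "nat \<Rightarrow> nat \<Rightarrow> (real^3 \<Rightarrow> real^3) \<Rightarrow> (state \<Rightarrow> state \<Rightarrow> state) \<Rightarrow> (node \<Rightarrow> state) \<Rightarrow> (node \<Rightarrow> state)
    \<Rightarrow> (nat \<Rightarrow> node \<Rightarrow> state) \<Rightarrow> (nat \<Rightarrow> node \<Rightarrow> state) \<Rightarrow> real" where
  "A_T N M X UK uL uR u \<phi> =
    ip_spacetime N M (\<lambda>\<sigma> \<nu>. jac N X \<nu> *\<^sub>R time_deriv M UK u \<sigma> \<nu>) \<phi>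
    + (ip_space N (\<lambda>\<nu>. jac N X \<nu> *\<^sub>R (uR \<nu> - u M \<nu>)) (\<phi> M)
       - ip_space N (\<lambda>\<nu>. jac N X \<nu> *\<^sub>R (uL \<nu> - u 0 \<nu>)) (\<phi> 0))"

text \<open>The argument \<open>fstar\<close> is the numerical flux in outward normal direction on the six faces.\<close>
definition A_S ::
  "real \<Rightarrow> nat \<Rightarrow> nat \<Rightarrow> (real^3 \<Rightarrow> real^3) \<Rightarrow> volume_flux \<Rightarrow> real \<Rightarrow>
    (face \<Rightarrow> nat \<Rightarrow> node \<Rightarrow> state) \<Rightarrow> (nat \<Rightarrow> node \<Rightarrow> state) \<Rightarrow> (nat \<Rightarrow> node \<Rightarrow> state) \<Rightarrow> real" where
  "A_S \<gamma> N M X FV \<Delta>t fstar u \<phi> =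
    \<Delta>t / 2 * ip_spacetime N M (\<lambda>\<sigma>. space_div \<gamma> N X FV (u \<sigma>)) \<phi>
    + \<Delta>t / 2 * (\<Sum>f\<in>UNIV. face_integral N M f (\<lambda>\<sigma> \<nu>.
        \<phi> \<sigma> \<nu> \<bullet> (fstar f \<sigma> \<nu>
          - (\<Sum>m\<in>UNIV. scaled_normal N X f \<nu> $ m *\<^sub>R euler_flux \<gamma> m (u \<sigma> \<nu>)))))"

text \<open>\<open>w k \<sigma> \<nu>\<close> are the states of all elements in one time slab. The second state is the one on the
  other side of the interface.\<close>
definition surface_flux ::
  "nat \<Rightarrow> hex_mesh \<Rightarrow> (3 \<Rightarrow> state \<Rightarrow> state \<Rightarrow> state) \<Rightarrow> (nat \<Rightarrow> nat \<Rightarrow> node \<Rightarrow> state)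
    \<Rightarrow> nat \<Rightarrow> face \<Rightarrow> nat \<Rightarrow> node \<Rightarrow> state" where
  "surface_flux N \<M> FS w k f \<sigma> \<nu> =
    (\<Sum>s\<in>UNIV. scaled_normal N (chart \<M> k) f \<nu> $ s *\<^sub>R
      FS s (w k \<sigma> \<nu>) (w (fst (nbr \<M> (k, f))) \<sigma> (glue \<M> (k, f) \<nu>)))"

text \<open>\<open>U n k \<sigma> \<nu>\<close> are the nodal values on space-time element \<open>(n, k)\<close> and \<open>Ustar n k \<nu>\<close>,
  \<open>0 \<le> n \<le> KT\<close>, is the single temporal state at the end of the \<open>n\<close>-th (start of the \<open>(n+1)\<close>-st)
  time interval. Nodal values of test functions are unrestricted.\<close>
definition dgsem_solution ::
  "real \<Rightarrow> nat \<Rightarrow> nat \<Rightarrow> nat \<Rightarrow> (nat \<Rightarrow> real) \<Rightarrow> hex_mesh \<Rightarrow> (state \<Rightarrow> state \<Rightarrow> state) \<Rightarrow> volume_flux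
    \<Rightarrow> (3 \<Rightarrow> state \<Rightarrow> state \<Rightarrow> state) \<Rightarrow> (nat \<Rightarrow> nat \<Rightarrow> node \<Rightarrow> state)
    \<Rightarrow> (nat \<Rightarrow> nat \<Rightarrow> nat \<Rightarrow> node \<Rightarrow> state) \<Rightarrow> bool" where
  "dgsem_solution \<gamma> N M KT dt \<M> UK FV FS Ustar U \<longleftrightarrow>
    (\<forall>n\<in>{1..KT}. \<forall>k\<in>{1..num_elems \<M>}. \<forall>\<phi> :: nat \<Rightarrow> node \<Rightarrow> state.
      A_T N M (chart \<M> k) UK (Ustar (n - 1) k) (Ustar n k) (U n k) \<phi>
      + A_S \<gamma> N M (chart \<M> k) FV (dt n) (surface_flux N \<M> FS (U n) k) (U n k) \<phi> = 0)"

definition total_kin :: "nat \<Rightarrow> hex_mesh \<Rightarrow> (nat \<Rightarrow> node \<Rightarrow> state) \<Rightarrow> real" where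
  "total_kin N \<M> w =
    (\<Sum>k=1..num_elems \<M>. ip_space N (\<lambda>\<nu>. kin (w k \<nu>)) (jac N (chart \<M> k)))"

text \<open>Integrand of the interface terms for the interface with minus side \<open>F\<close>; the normal points from
  the minus to the plus side and the jump is plus minus minus.\<close>
definition interface_work ::
  "real \<Rightarrow> nat \<Rightarrow> hex_mesh \<Rightarrow> (nat \<Rightarrow> nat \<Rightarrow> node \<Rightarrow> state) \<Rightarrow> nat \<times> face \<Rightarrow> nat \<Rightarrow> node \<Rightarrow> real" where
  "interface_work \<gamma> N \<M> w F \<sigma> \<nu> =
    (let um = w (fst F) \<sigma> \<nu>;
         up = w (fst (nbr \<M> F)) \<sigma> (glue \<M> F \<nu>)
     in mean (pres \<gamma> up) (pres \<gamma> um)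
        * (scaled_normal N (chart \<M> (fst F)) (snd F) \<nu> \<bullet> (vel up - vel um)))"

end

theory Submission
  imports Defs
begin

text \<open>
  The scheme is tested with the kinetic energy variables \<open>V = \<partial>\<kappa>/\<partial>u\<close>, which have vanishing energy
  component. Everything then rests on one algebraic identity: if a two-point quantity \<open>w\<close> has the
  momentum part \<open>dens w \<cdot> {v} + q\<close> with \<open>{v}\<close> the mean of the velocities of \<open>a\<close> and \<open>b\<close>, then
  \<open>V(a) \<bullet> w = (1/2) dens w (v\<^sub>a \<bullet> v\<^sub>b) + v\<^sub>a \<bullet> q\<close> (\<open>kev_inner_mean\<close>). The first summand is symmetric in
  \<open>a\<close> and \<open>b\<close>, so that only \<open>q\<close> contributes to the jump: \<open>(V(a) - V(b)) \<bullet> w = (v\<^sub>a - v\<^sub>b) \<bullet> q\<close>.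
  The temporal states have \<open>q = 0\<close>, and in the fluxes \<open>q\<close> is a pressure term.

  Symmetric two-point terms reduce to boundary terms by summation by parts: with the
  Legendre-Gauss-Lobatto weights \<open>\<omega>\<close> and the derivative matrix \<open>D\<close>, the matrix \<open>Q = diag(\<omega>) D\<close> satisfies
  \<open>Q + Q\<^sup>T = diag(-1, 0, \<dots>, 0, 1)\<close> (\<open>summation_by_parts\<close>). This holds because the quadrature integrates
  polynomials of degree below \<open>2N\<close> exactly, which in turn follows from the orthogonality of
  \<open>(1 - x\<^sup>2) P\<^sub>N'\<close> to all polynomials of degree at most \<open>N - 2\<close>.

  In time, the volume term becomes the difference of the kinetic energies at the two ends of a slab.
  The numerical states then telescope over the slabs, since their contributions from the two sides of an interior
  interface agree; only the final energy and \<open>V \<bullet> u\<close> at the initial interface survive (\<open>A_T_kev\<close>).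
  In space, the convective part of the volume flux is symmetric and leaves a boundary term. In the pressure part
  the metric mean cancels to \<open>(p\<^sub>a B + p\<^sub>b A)/2\<close>, where \<open>A\<close> and \<open>B\<close> are the metric terms belonging to \<open>a\<close> and \<open>b\<close>:
  the part with \<open>p\<^sub>a\<close> vanishes by the discrete metric identities, and the other one is the contravariant
  velocity times the pressure gradient, hence by summation by parts minus the pressure times the velocity
  divergence, up to a boundary term. All boundary terms cancel against the interior flux in the surface
  integral (\<open>A_S_kev\<close>), so that the numerical fluxes alone remain there. Adding the two sides of
  an interface gives minus the work of the mean pressure on the velocity jump (\<open>sum_surface_flux_kev\<close>);
  the quadrature weights on both sides agree because the nodes are symmetric about the origin.
\<close>

section \<open>Legendre polynomials\<close>

definition poly_integral :: "real poly \<Rightarrow> real" where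
  "poly_integral p = integral {-1..1} (poly p)"

lemma poly_integrable: "poly (p :: real poly) integrable_on {a..b}"
  by (intro integrable_continuous_interval continuous_intros)

lemma poly_integral_add: "poly_integral (p + q) = poly_integral p + poly_integral q"
  using integral_add[OF poly_integrable[of p "-1" 1] poly_integrable[of q "-1" 1]]
  by (simp add: poly_integral_def poly_add[abs_def])

lemma poly_integral_smult: "poly_integral (smult c p) = c * poly_integral p"
  unfolding poly_integral_def by (simp add: poly_smult[abs_def])

lemma poly_integral_0: "poly_integral 0 = 0"
  by (simp add: poly_integral_def poly_0[abs_def])

lemma poly_integral_sum: "poly_integral (sum f A) = (\<Sum>x\<in>A. poly_integral (f x))"
  by (induction A rule: infinite_finite_induct) (simp_all add: poly_integral_0 poly_integral_add)

lemma poly_integral_pderiv: "poly_integral (pderiv p) = poly p 1 - poly p (-1)"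
proof -
  have "(poly (pderiv p) has_integral poly p 1 - poly p (-1)) {-1..1}"
    by (rule fundamental_theorem_of_calculus)
       (auto intro!: has_field_derivative_at_within poly_DERIV
         simp flip: has_real_derivative_iff_has_vector_derivative)
  then show ?thesis by (simp add: poly_integral_def integral_unique)
qed

lemma poly_integral_by_parts:
  assumes "poly p 1 * poly q 1 = 0" "poly p (-1) * poly q (-1) = 0"
  shows "poly_integral (pderiv p * q) = - poly_integral (p * pderiv q)"
proof -
  have "poly_integral (pderiv p * q + p * pderiv q) = 0"
    using poly_integral_pderiv[of "p * q"] assms by (simp add: pderiv_mult algebra_simps)
  then show ?thesis by (simp add: poly_integral_add)
qed

lemma power_dvd_pderiv:
  fixes p r :: "'a::idom poly"
  assumes "p ^ Suc m dvd r"
  shows "p ^ m dvd pderiv r"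
proof -
  obtain s where r: "r = p ^ Suc m * s" using assms by (auto simp: dvd_def)
  show ?thesis unfolding r pderiv_mult pderiv_power_Suc by (simp add: dvd_smult dvd_add)
qed

text \<open>Each differentiation lowers the multiplicity of a root by at most one.\<close>
lemma power_dvd_funpow_pderiv:
  fixes p :: "'a::idom poly"
  shows "p ^ m dvd (pderiv ^^ k) (p ^ (m + k))"
proof (induction k arbitrary: m)
  case (Suc k)
  show ?case using power_dvd_pderiv[OF Suc[of "Suc m"]] by simp
qed simp

lemma funpow_pderiv_rodrigues_zero:
  assumes "k < n" "x = 1 \<or> x = -1"
  shows "poly ((pderiv ^^ k) ([:-1, 0, 1:] ^ n)) x = (0::real)"
proof -
  have "[:-1, 0, 1:] ^ (n - k) dvd (pderiv ^^ k) ([:-1, 0, 1::real:] ^ n)"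
    using power_dvd_funpow_pderiv[of "[:-1, 0, 1::real:]" "n - k" k] assms by simp
  then obtain s where "(pderiv ^^ k) ([:-1, 0, 1::real:] ^ n) = [:-1, 0, 1:] ^ (n - k) * s"
    by (auto simp: dvd_def)
  then show ?thesis using assms by (auto simp: power_0_left)
qed

text \<open>All derivatives of \<open>(x\<^sup>2 - 1)^n\<close> of order below \<open>n\<close> vanish at the end points, so integration by parts
  moves \<open>k\<close> derivatives onto \<open>q\<close> without boundary terms and annihilates it.\<close>
lemma rodrigues_orthogonal:
  "k \<le> n \<Longrightarrow> degree q < k \<Longrightarrow> poly_integral ((pderiv ^^ k) ([:-1, 0, 1:] ^ n) * q) = 0"
proof (induction k arbitrary: q)
  case (Suc k)
  let ?A = "(pderiv ^^ k) ([:-1, 0, 1::real:] ^ n)"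
  have "poly_integral (pderiv ?A * q) = - poly_integral (?A * pderiv q)"
    using Suc.prems by (intro poly_integral_by_parts) (simp_all add: funpow_pderiv_rodrigues_zero)
  also have "poly_integral (?A * pderiv q) = 0"
  proof (cases "degree q = 0")
    case True
    then have "pderiv q = 0" by (simp add: pderiv_eq_0_iff)
    then show ?thesis by (simp add: poly_integral_0)
  next
    case False
    then show ?thesis using Suc.prems by (intro Suc.IH) (simp_all add: degree_pderiv)
  qed
  finally show ?case by simp
qed simp

lemma legendre_orthogonal:
  assumes "degree q < n"
  shows "poly_integral (legendre n * q) = 0"
  using rodrigues_orthogonal[OF order_refl assms]
  by (simp add: legendre_def poly_integral_smult)

lemma degree_funpow_pderiv: "degree ((pderiv ^^ k) (p :: real poly)) = degree p - k"
  by (induction k) (simp_all add: degree_pderiv)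

lemma degree_legendre: "degree (legendre n) = n"
  by (simp add: legendre_def degree_funpow_pderiv degree_power_eq)

section \<open>Legendre-Gauss-Lobatto nodes\<close>

definition lobatto_poly :: "nat \<Rightarrow> real poly" where
  "lobatto_poly N = [:1, 0, -1:] * pderiv (legendre N)"

lemma pderiv_legendre_neq_0: "1 \<le> N \<Longrightarrow> pderiv (legendre N) \<noteq> 0"
  by (metis degree_legendre not_one_le_zero pderiv_eq_0_iff)

lemma degree_lobatto_poly:
  assumes "1 \<le> N"
  shows "degree (lobatto_poly N) = N + 1"
proof -
  have "degree (lobatto_poly N) = degree [:1, 0, -1::real:] + degree (pderiv (legendre N))"
    unfolding lobatto_poly_def
    by (rule degree_mult_eq) (use pderiv_legendre_neq_0[OF assms] in simp_all)
  then show ?thesis using assms by (simp add: degree_pderiv degree_legendre)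
qed

lemma rolle_roots:
  fixes p :: "real poly"
  assumes "finite S" "card S = Suc m" "\<And>x. x \<in> S \<Longrightarrow> poly p x = 0"
  shows "\<exists>R. finite R \<and> card R = m \<and> (\<forall>x\<in>R. poly (pderiv p) x = 0 \<and> Min S < x \<and> x < Max S)"
  using assms
proof (induction m arbitrary: S)
  case 0
  then show ?case by (intro exI[of _ "{}"]) simp
next
  case (Suc m)
  define b where "b = Max S"
  define S' where "S' = S - {b}"
  have ne: "S \<noteq> {}" using Suc.prems by auto
  have bS: "b \<in> S" using Suc.prems ne by (simp add: b_def)
  have S': "finite S'" "card S' = Suc m" using Suc.prems bS by (simp_all add: S'_def)
  then have ne': "S' \<noteq> {}" by auto
  obtain R where R: "finite R" "card R = m"
      "\<forall>x\<in>R. poly (pderiv p) x = 0 \<and> Min S' < x \<and> x < Max S'"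
    using Suc.IH[OF S'] Suc.prems by (auto simp: S'_def)
  have mem: "Max S' \<in> S'" using S' ne' by simp
  have lt: "Max S' < b"
    using mem Suc.prems(1) Max_ge[of S "Max S'"] by (auto simp: S'_def b_def order_le_less)
  obtain c where c: "Max S' < c" "c < b" "poly (pderiv p) c = 0"
    using poly_MVT[OF lt, of p] Suc.prems(3)[OF bS] Suc.prems(3)[of "Max S'"] mem lt
    by (auto simp: S'_def)
  have min: "Min S \<le> Min S'" using Suc.prems S' ne' by (intro Min_antimono) (auto simp: S'_def)
  have "Min S' \<le> Max S'" using S' ne' by simp
  then have "card (insert c R) = Suc m" "\<forall>x\<in>insert c R. poly (pderiv p) x = 0 \<and> Min S < x \<and> x < b"
    using R c min lt by (fastforce simp: card_insert_if)+
  then show ?case using R by (intro exI[of _ "insert c R"]) (simp add: b_def)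
qed

text \<open>Rolle's theorem applied to the roots of the preceding derivative together with the two end points,
  which are roots as long as the order of that derivative is below \<open>n\<close>.\<close>
lemma rodrigues_roots:
  "k \<le> n \<Longrightarrow> \<exists>R. finite R \<and> card R = k \<and>
    (\<forall>x\<in>R. poly ((pderiv ^^ k) ([:-1, 0, 1:] ^ n)) x = 0 \<and> -1 < x \<and> x < (1::real))"
proof (induction k)
  case 0
  show ?case by (intro exI[of _ "{}"]) simp
next
  case (Suc k)
  then obtain R where R: "finite R" "card R = k"
      "\<forall>x\<in>R. poly ((pderiv ^^ k) ([:-1, 0, 1:] ^ n)) x = 0 \<and> -1 < x \<and> x < (1::real)"
    by auto
  let ?S = "insert (-1) (insert 1 R)"
  have "finite ?S" "card ?S = Suc (Suc k)" using R by (auto simp: card_insert_if)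
  moreover have "\<And>x. x \<in> ?S \<Longrightarrow> poly ((pderiv ^^ k) ([:-1, 0, 1:] ^ n)) x = 0"
    using R Suc.prems funpow_pderiv_rodrigues_zero[of k n] by auto
  moreover have "Min ?S = -1" by (rule Min_eqI) (use R in \<open>auto simp: less_imp_le\<close>)
  moreover have "Max ?S = 1" by (rule Max_eqI) (use R in \<open>auto simp: less_imp_le\<close>)
  ultimately show ?case using rolle_roots[of ?S "Suc k"] by simp
qed

text \<open>The roots of \<open>P\<^sub>N\<close> interlace with \<open>N - 1\<close> roots of \<open>P\<^sub>N'\<close>. Together with the two end points they exhaust the
  degree, so the list of nodes really has \<open>N + 1\<close> entries.\<close>
lemma lobatto_roots:
  assumes "1 \<le> N"
  shows "finite {x. poly (lobatto_poly N) x = 0}" "card {x. poly (lobatto_poly N) x = 0} = N + 1"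
    "{x. poly (lobatto_poly N) x = 0} \<subseteq> {-1..1}"
proof -
  let ?Z = "{x. poly (lobatto_poly N) x = 0}"
  have nz: "lobatto_poly N \<noteq> 0" using degree_lobatto_poly[OF assms] by auto
  show fin: "finite ?Z" using poly_roots_finite[OF nz] .
  obtain R where R: "finite R" "card R = N"
      "\<forall>x\<in>R. poly (legendre N) x = 0 \<and> -1 < x \<and> x < 1"
    using rodrigues_roots[of N N] by (auto simp: legendre_def)
  then obtain R' where R': "finite R'" "card R' = N - 1"
      "\<forall>x\<in>R'. poly (pderiv (legendre N)) x = 0 \<and> Min R < x \<and> x < Max R"
    using rolle_roots[of R "N - 1" "legendre N"] assms by auto
  have "R \<noteq> {}" using R assms by auto
  then have "Min R \<in> R" "Max R \<in> R" using R by simp_all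
  then have in': "\<forall>x\<in>R'. -1 < x \<and> x < 1" using R R' by fastforce
  let ?S = "insert (-1) (insert 1 R')"
  have sub: "?S \<subseteq> ?Z" using R' by (auto simp: lobatto_poly_def)
  have cS: "card ?S = N + 1" using R' in' assms by (auto simp: card_insert_if)
  have "card ?Z \<le> N + 1" using card_poly_roots_bound[OF nz] degree_lobatto_poly[OF assms] by simp
  then have eq: "?S = ?Z" using card_seteq[OF fin sub] cS by simp
  show "card ?Z = N + 1" using eq cS by simp
  have "?S \<subseteq> {-1..1}" using in' by (auto simp: less_imp_le)
  then show "?Z \<subseteq> {-1..1}" unfolding eq .
qed

lemma lgl_node_alt: "lgl_node N i = sorted_list_of_set {x. poly (lobatto_poly N) x = 0} ! i"
  by (simp add: lgl_node_def lobatto_poly_def)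

lemma lgl_node_image:
  assumes "1 \<le> N"
  shows "lgl_node N ` {..N} = {x. poly (lobatto_poly N) x = 0}"
proof -
  let ?xs = "sorted_list_of_set {x. poly (lobatto_poly N) x = 0}"
  have "set ?xs = (!) ?xs ` {..<length ?xs}" by (auto simp: set_conv_nth)
  moreover have "{..<length ?xs} = {..N}" using lobatto_roots(2)[OF assms] by auto
  ultimately show ?thesis
    using lobatto_roots(1)[OF assms] by (simp add: lgl_node_alt[abs_def])
qed

lemma lgl_node_root: "1 \<le> N \<Longrightarrow> i \<le> N \<Longrightarrow> poly (lobatto_poly N) (lgl_node N i) = 0"
  using lgl_node_image[of N] by blast

lemma lgl_node_strict_mono:
  assumes "1 \<le> N" "i < j" "j \<le> N"
  shows "lgl_node N i < lgl_node N j"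
  using assms strict_sorted_list_of_set[of "{x. poly (lobatto_poly N) x = 0}"]
    lobatto_roots(2)[of N]
  by (auto simp: lgl_node_alt strict_sorted_iff sorted_wrt_iff_nth_less)

lemma lgl_node_eq_iff:
  "1 \<le> N \<Longrightarrow> i \<le> N \<Longrightarrow> j \<le> N \<Longrightarrow> lgl_node N i = lgl_node N j \<longleftrightarrow> i = j"
  using lgl_node_strict_mono[of N i j] lgl_node_strict_mono[of N j i]
  by (metis less_irrefl nat_neq_iff)

lemma lgl_node_in: "1 \<le> N \<Longrightarrow> i \<le> N \<Longrightarrow> lgl_node N i \<in> {-1..1}"
  using lobatto_roots(3)[of N] lgl_node_root[of N i] by blast

lemma lgl_node_ends:
  assumes "1 \<le> N"
  shows "lgl_node N 0 = -1" "lgl_node N N = 1"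
proof -
  have mem: "-1 \<in> lgl_node N ` {..N}" "1 \<in> lgl_node N ` {..N}"
    unfolding lgl_node_image[OF assms] by (simp_all add: lobatto_poly_def)
  then obtain i j where ij: "i \<le> N" "lgl_node N i = -1" "j \<le> N" "lgl_node N j = 1"
    by (auto simp: image_iff)
  show "lgl_node N 0 = -1"
    using ij lgl_node_in[OF assms, of 0] lgl_node_strict_mono[OF assms, of 0 i] by (cases "i = 0") auto
  show "lgl_node N N = 1"
    using ij lgl_node_in[OF assms, of N] lgl_node_strict_mono[OF assms, of j N] by (cases "j = N") auto
qed

lemma funpow_pderiv_reflect:
  fixes p :: "real poly"
  assumes "pcompose p [:0, -1:] = p"
  shows "pcompose ((pderiv ^^ k) p) [:0, -1:] = smult ((-1) ^ k) ((pderiv ^^ k) p)"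
proof (induction k)
  case (Suc k)
  have "pderiv (pcompose ((pderiv ^^ k) p) [:0, -1:])
      = - pcompose (pderiv ((pderiv ^^ k) p)) [:0, -1:]"
    by (simp add: pderiv_pcompose pderiv_pCons)
  then have "pcompose (pderiv ((pderiv ^^ k) p)) [:0, -1:]
      = - pderiv (pcompose ((pderiv ^^ k) p) [:0, -1:])" by simp
  then show ?case using Suc by (simp add: pderiv_smult)
qed (simp add: assms)

text \<open>The polynomial \<open>(x\<^sup>2 - 1)^N\<close> is even, so each of its derivatives is even or odd.\<close>
lemma lobatto_poly_reflect: "poly (lobatto_poly N) (- x) = 0 \<longleftrightarrow> poly (lobatto_poly N) x = 0"
proof -
  have "pcompose ([:-1, 0, 1::real:] ^ N) [:0, -1:] = [:-1, 0, 1:] ^ N"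
    using pcompose_prod[of "\<lambda>_. [:-1, 0, 1::real:]" "{..<N}"] by (simp add: pcompose_pCons)
  from arg_cong[OF funpow_pderiv_reflect[OF this, of "Suc N"], of "\<lambda>p. poly p x"]
  have "poly ((pderiv ^^ Suc N) ([:-1, 0, 1::real:] ^ N)) (- x)
      = (-1) ^ Suc N * poly ((pderiv ^^ Suc N) ([:-1, 0, 1:] ^ N)) x"
    by (simp add: poly_pcompose del: funpow.simps)
  then show ?thesis
    by (auto simp: lobatto_poly_def legendre_def pderiv_smult)
qed

text \<open>Negating and reversing the sorted list of nodes yields a sorted list with the same elements, hence the
  same list.\<close>
lemma lgl_node_reflect:
  assumes "1 \<le> N" "i \<le> N"
  shows "lgl_node N (N - i) = - lgl_node N i"
proof -
  let ?Z = "{x. poly (lobatto_poly N) x = 0}"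
  let ?xs = "sorted_list_of_set ?Z"
  note Z = lobatto_roots[OF assms(1)]
  have len: "length ?xs = N + 1" using Z by simp
  have "uminus ` ?Z = ?Z"
    using lobatto_poly_reflect by (auto simp: image_iff) (metis minus_minus)
  then have "set (map uminus (rev ?xs)) = set ?xs" using Z by simp
  moreover have "sorted (map uminus (rev ?xs))"
    by (simp add: sorted_map sorted_wrt_rev flip: sorted_wrt_map)
  ultimately have "map uminus (rev ?xs) = ?xs"
    by (intro sorted_distinct_set_unique) (simp_all add: distinct_map)
  then have "?xs ! (N - i) = map uminus (rev ?xs) ! (N - i)" by simp
  also have "\<dots> = - (?xs ! i)" using assms len by (simp add: rev_nth)
  finally show ?thesis by (simp add: lgl_node_alt)
qed

section \<open>Legendre-Gauss-Lobatto quadrature and summation by parts\<close>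

lemma lagrange_node:
  assumes "1 \<le> N" "i \<le> N" "j \<le> N"
  shows "poly (lagrange N j) (lgl_node N i) = (if i = j then 1 else 0)"
proof (cases "i = j")
  case True
  then show ?thesis using assms
    by (auto simp: lagrange_def poly_prod lgl_node_eq_iff simp flip: diff_divide_distrib
        intro!: prod.neutral)
next
  case False
  then show ?thesis using assms by (auto simp: lagrange_def poly_prod intro!: prod_zero)
qed

lemma degree_lagrange:
  assumes "j \<le> N"
  shows "degree (lagrange N j) \<le> N"
proof -
  have "degree (lagrange N j) \<le> (\<Sum>i\<in>{..N} - {j}.
      degree (smult (1 / (lgl_node N j - lgl_node N i)) [:- lgl_node N i, 1:]))"
    unfolding lagrange_def by (rule degree_prod_sum_le[unfolded comp_def]) simp
  also have "\<dots> \<le> (\<Sum>i\<in>{..N} - {j}. 1)" by (intro sum_mono) simp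
  finally show ?thesis using assms by simp
qed

lemma poly_eq_at_nodes:
  assumes "1 \<le> N" "degree p \<le> N" "degree q \<le> N"
    "\<And>i. i \<le> N \<Longrightarrow> poly p (lgl_node N i) = poly q (lgl_node N i)"
  shows "p = q"
proof (rule poly_eqI_degree)
  show "degree p < card (lgl_node N ` {..N})" "degree q < card (lgl_node N ` {..N})"
    using assms(2,3) lobatto_roots(2)[OF assms(1)] by (simp_all add: lgl_node_image[OF assms(1)])
qed (use assms(4) in auto)

lemma lagrange_interpolation:
  assumes "1 \<le> N" "degree p \<le> N"
  shows "p = (\<Sum>i\<le>N. smult (poly p (lgl_node N i)) (lagrange N i))"
proof (rule poly_eq_at_nodes[OF assms])
  show "degree (\<Sum>i\<le>N. smult (poly p (lgl_node N i)) (lagrange N i)) \<le> N"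
    by (intro degree_sum_le) (auto intro: order_trans[OF degree_smult_le] degree_lagrange)
qed (simp add: poly_sum lagrange_node[OF assms(1)] if_distrib cong: if_cong)

lemma lgl_weight_alt: "lgl_weight N i = poly_integral (lagrange N i)"
  by (simp add: lgl_weight_def poly_integral_def)

text \<open>After one integration by parts, in which the factor \<open>1 - x\<^sup>2\<close> removes the boundary terms, \<open>P\<^sub>N\<close> is tested with
  a polynomial of degree at most \<open>N - 1\<close>.\<close>
lemma lobatto_poly_orthogonal:
  assumes "q = 0 \<or> degree q + 2 \<le> N"
  shows "poly_integral (lobatto_poly N * q) = 0"
proof (cases "q = 0")
  case False
  then have q: "degree q + 2 \<le> N" using assms by simp
  let ?r = "[:1, 0, -1:] * q"
  have "degree (pderiv ?r) < N"
    using q False degree_mult_eq[of "[:1, 0, -1::real:]" q] by (simp add: degree_pderiv)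
  then have "poly_integral (legendre N * pderiv ?r) = 0" by (rule legendre_orthogonal)
  moreover have "poly_integral (pderiv (legendre N) * ?r) = - poly_integral (legendre N * pderiv ?r)"
    by (rule poly_integral_by_parts) simp_all
  ultimately show ?thesis by (simp add: lobatto_poly_def algebra_simps)
qed (simp add: poly_integral_0)

text \<open>Division by \<open>(1 - x\<^sup>2) P\<^sub>N'\<close> leaves a quotient that is too small in degree to contribute to the integral,
  and a remainder that has the same nodal values and is reproduced by interpolation.\<close>
lemma lgl_quadrature_exact:
  assumes "1 \<le> N" "degree p < 2 * N"
  shows "poly_integral p = (\<Sum>i\<le>N. lgl_weight N i * poly p (lgl_node N i))"
proof -
  let ?g = "lobatto_poly N"
  let ?q = "p div ?g" and ?r = "p mod ?g"
  have dg: "degree ?g = N + 1" by (rule degree_lobatto_poly[OF assms(1)])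
  then have g0: "?g \<noteq> 0" by auto
  have r: "degree ?r \<le> N" using degree_mod_less[OF g0, of p] dg by auto
  have p: "p = ?g * ?q + ?r" by simp
  have "degree ?q + 2 \<le> N" if "?q \<noteq> 0"
  proof -
    have "degree (?g * ?q) = N + 1 + degree ?q" using that g0 dg by (simp add: degree_mult_eq)
    moreover from this have "degree (?g * ?q + ?r) = degree (?g * ?q)"
      using r by (intro degree_add_eq_left) simp
    ultimately show ?thesis using p assms(2) by simp
  qed
  then have q: "?q = 0 \<or> degree ?q + 2 \<le> N" by blast
  have at: "poly ?r (lgl_node N i) = poly p (lgl_node N i)" if "i \<le> N" for i
  proof -
    have "poly (?g * ?q) (lgl_node N i) + poly ?r (lgl_node N i) = poly p (lgl_node N i)"
      by (simp only: poly_add[symmetric] mult_div_mod_eq)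
    then show ?thesis using lgl_node_root[OF assms(1) that] by simp
  qed
  have "poly_integral p = poly_integral ?r"
    using lobatto_poly_orthogonal[OF q] poly_integral_add[of "?g * ?q" ?r] by simp
  also have "\<dots> = (\<Sum>i\<le>N. poly ?r (lgl_node N i) * lgl_weight N i)"
    by (subst lagrange_interpolation[OF assms(1) r])
       (simp add: poly_integral_sum poly_integral_smult lgl_weight_alt)
  finally show ?thesis by (simp add: at mult.commute)
qed

lemma lgl_weight_reflect:
  assumes "1 \<le> N" "j \<le> N"
  shows "lgl_weight N (N - j) = lgl_weight N j"
proof -
  have eq: "lagrange N (N - j) = pcompose (lagrange N j) [:0, -1:]"
  proof (rule poly_eq_at_nodes[OF assms(1)])
    fix i assume i: "i \<le> N"
    have "poly (pcompose (lagrange N j) [:0, -1:]) (lgl_node N i)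
        = poly (lagrange N j) (lgl_node N (N - i))"
      using i by (simp add: poly_pcompose lgl_node_reflect[OF assms(1)])
    also have "\<dots> = poly (lagrange N (N - j)) (lgl_node N i)"
      using i assms by (subst (1 2) lagrange_node) auto
    finally show "poly (lagrange N (N - j)) (lgl_node N i)
        = poly (pcompose (lagrange N j) [:0, -1:]) (lgl_node N i)" ..
  qed (use degree_lagrange assms in \<open>auto simp: degree_pcompose\<close>)
  show ?thesis
    using Henstock_Kurzweil_Integration.integral_reflect_real[of 1 "-1" "poly (lagrange N j)"]
    by (simp add: lgl_weight_def eq poly_pcompose[abs_def])
qed

lemma lgl_weight_dmat:
  assumes "1 \<le> N" "i \<le> N" "j \<le> N"
  shows "lgl_weight N i * dmat N i j = poly_integral (lagrange N i * pderiv (lagrange N j))"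
proof -
  have "degree (lagrange N i * pderiv (lagrange N j))
      \<le> degree (lagrange N i) + degree (pderiv (lagrange N j))"
    by (rule degree_mult_le)
  then have "degree (lagrange N i * pderiv (lagrange N j)) < 2 * N"
    using degree_lagrange[of i N] degree_lagrange[of j N] assms by (simp add: degree_pderiv)
  from lgl_quadrature_exact[OF assms(1) this] show ?thesis
    using assms by (simp add: lagrange_node dmat_def if_distrib if_distribR cong: if_cong)
qed

text \<open>By exactness of the quadrature the left-hand side is the integral of the derivative of the product of two
  Lagrange polynomials; the product is evaluated at the end points, which are nodes.\<close>
lemma summation_by_parts_matrix:
  assumes "1 \<le> N" "i \<le> N" "j \<le> N"
  shows "lgl_weight N i * dmat N i j + lgl_weight N j * dmat N j i
    = (if i = N \<and> j = N then 1 else 0) - (if i = 0 \<and> j = 0 then 1 else 0)"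
proof -
  have end1: "poly (lagrange N k) 1 = (if k = N then 1 else 0)"
    and end2: "poly (lagrange N k) (-1) = (if k = 0 then 1 else 0)" if "k \<le> N" for k
    using lagrange_node[OF assms(1) order_refl that] lagrange_node[OF assms(1) _ that, of 0]
    by (auto simp: lgl_node_ends[OF assms(1)])
  have "lgl_weight N i * dmat N i j + lgl_weight N j * dmat N j i
      = poly_integral (pderiv (lagrange N i * lagrange N j))"
    using assms by (simp add: lgl_weight_dmat pderiv_mult poly_integral_add mult.commute)
  then show ?thesis using assms by (auto simp: poly_integral_pderiv end1 end2)
qed

text \<open>In this form it applies to symmetric two-point terms as well as to products \<open>f i * g j\<close>, for which it is
  the discrete product rule.\<close>
lemma summation_by_parts:
  assumes "1 \<le> N"
  shows "(\<Sum>i\<le>N. \<Sum>j\<le>N. lgl_weight N i * dmat N i j * (S i j + S j i)) = S N N - S 0 0"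
proof -
  have "(\<Sum>i\<le>N. \<Sum>j\<le>N. lgl_weight N i * dmat N i j * (S i j + S j i))
      = (\<Sum>i\<le>N. \<Sum>j\<le>N. lgl_weight N i * dmat N i j * S i j)
        + (\<Sum>i\<le>N. \<Sum>j\<le>N. lgl_weight N i * dmat N i j * S j i)"
    by (simp add: sum.distrib distrib_left)
  also have "(\<Sum>i\<le>N. \<Sum>j\<le>N. lgl_weight N i * dmat N i j * S j i)
      = (\<Sum>i\<le>N. \<Sum>j\<le>N. lgl_weight N j * dmat N j i * S i j)"
    by (rule sum.swap)
  also have "(\<Sum>i\<le>N. \<Sum>j\<le>N. lgl_weight N i * dmat N i j * S i j) + \<dots>
      = (\<Sum>i\<le>N. \<Sum>j\<le>N. ((if i = N \<and> j = N then 1 else 0) - (if i = 0 \<and> j = 0 then 1 else 0)) * S i j)"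
    by (simp add: sum.distrib[symmetric] distrib_right[symmetric] summation_by_parts_matrix[OF assms])
  also have "\<dots> = (\<Sum>i\<le>N. \<Sum>j\<le>N. if i = N then (if j = N then S i j else 0) else 0)
      - (\<Sum>i\<le>N. \<Sum>j\<le>N. if i = 0 then (if j = 0 then S i j else 0) else 0)"
    by (auto simp: left_diff_distrib sum_subtractf intro!: arg_cong2[of _ _ _ _ minus] sum.cong)
  also have "\<dots> = S N N - S 0 0"
    by (simp add: if_distrib[of "\<lambda>f. sum f _"] sum.If_cases cong: if_cong)
       (simp add: sum.delta if_distrib cong: if_cong)?
  finally show ?thesis .
qed

section \<open>Nodal differentiation on the reference cube\<close>

definition nodal_partial :: "nat \<Rightarrow> 3 \<Rightarrow> (node \<Rightarrow> real) \<Rightarrow> node \<Rightarrow> real" where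
  "nodal_partial N l f \<nu> = (\<Sum>m\<le>N. dmat N (\<nu> l) m * f (\<nu>(l := m)))"

lemma nodes_eq_Pi: "nodes N = Pi\<^sub>E UNIV (\<lambda>_. {..N})"
  by (auto simp: nodes_def PiE_def Pi_def)

lemma finite_nodes [simp]: "finite (nodes N)"
  unfolding nodes_eq_Pi by (rule finite_PiE) auto

lemma nodes_le: "\<nu> \<in> nodes N \<Longrightarrow> \<nu> l \<le> N"
  by (simp add: nodes_def)

lemma nodes_upd: "\<nu> \<in> nodes N \<Longrightarrow> m \<le> N \<Longrightarrow> \<nu>(l := m) \<in> nodes N"
  by (simp add: nodes_def)

lemma pt_in_ref_cube: "1 \<le> N \<Longrightarrow> \<nu> \<in> nodes N \<Longrightarrow> pt N \<nu> \<in> ref_cube"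
  using lgl_node_in[of N "\<nu> l" for l]
  by (auto simp: ref_cube_def pt_def mem_box_cart nodes_le)

text \<open>At boundary points the derivative within the cube is still unique, because the cube has nonempty interior.\<close>
lemma partial_eqI:
  assumes "(g has_derivative g') (at x)" "x \<in> ref_cube"
  shows "partial l g x = g' (axis l 1)"
proof -
  have d: "(g has_derivative g') (at x within ref_cube)"
    using assms(1) by (rule has_derivative_at_withinI)
  have pos: "vec (-1) \<bullet> i < vec 1 \<bullet> i" if "i \<in> Basis" for i :: "real^3"
    using that by (auto simp: Basis_vec_def inner_axis)
  have "frechet_derivative g (at x within ref_cube) = g'"
    using frechet_derivative_unique_within_closed_interval[of "vec (-1)" "vec 1" x g, OF pos]
      d assms(2) frechet_derivative_works[of g "at x within ref_cube"]
    unfolding ref_cube_def differentiable_def by blast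
  then show ?thesis by (simp add: partial_def)
qed

lemma has_derivative_interp:
  "(interp N f has_derivative (\<lambda>y. \<Sum>\<mu>\<in>nodes N. f \<mu> * (\<Sum>i\<in>UNIV.
      (poly (pderiv (lagrange N (\<mu> i))) (x $ i) * y $ i) *
      (\<Prod>j\<in>UNIV - {i}. poly (lagrange N (\<mu> j)) (x $ j))))) (at x)"
proof -
  have *: "((\<lambda>x. poly p (x $ i)) has_derivative (\<lambda>y. poly (pderiv p) (x $ i) * y $ i)) (at x)"
    for p and i :: 3
    using DERIV_compose_FDERIV[OF poly_DERIV
        bounded_linear.has_derivative[OF bounded_linear_vec_nth has_derivative_ident]]
    by (simp add: mult.commute)
  show ?thesis
    unfolding interp_def by (intro has_derivative_sum has_derivative_mult_right has_derivative_prod *)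
qed

lemma partial_interp:
  assumes "1 \<le> N" "\<nu> \<in> nodes N"
  shows "partial l (interp N f) (pt N \<nu>) = nodal_partial N l f \<nu>"
proof -
  note le = nodes_le[OF assms(2)]
  have prod_lagrange: "(\<Prod>j\<in>UNIV - {l}. poly (lagrange N (\<mu> j)) (pt N \<nu> $ j))
      = (if \<forall>j. j \<noteq> l \<longrightarrow> \<mu> j = \<nu> j then 1 else 0)" if "\<mu> \<in> nodes N" for \<mu>
  proof -
    have "poly (lagrange N (\<mu> j)) (pt N \<nu> $ j) = (if \<nu> j = \<mu> j then 1 else 0)" for j
      using lagrange_node[OF assms(1) le nodes_le[OF that]] by (simp add: pt_def)
    \<comment> \<open>A single index off the line through the node in direction \<open>l\<close> makes a factor vanish.\<close>
    then show ?thesis by (auto intro!: prod.neutral prod_zero) (metis DiffI UNIV_I singletonD)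
  qed
  have upd: "\<nu>(l := \<mu> l) = \<mu>" if "\<forall>j. j \<noteq> l \<longrightarrow> \<mu> j = \<nu> j" for \<mu>
    using that by (auto simp: fun_eq_iff)
  let ?d = "\<lambda>\<mu>::node. dmat N (\<nu> l) (\<mu> l)"
  have "partial l (interp N f) (pt N \<nu>)
      = (\<Sum>\<mu>\<in>nodes N. f \<mu> * (?d \<mu> * (\<Prod>j\<in>UNIV - {l}. poly (lagrange N (\<mu> j)) (pt N \<nu> $ j))))"
    by (subst partial_eqI[OF has_derivative_interp pt_in_ref_cube[OF assms]])
       (simp add: axis_def pt_def dmat_def if_distrib if_distribR cong: if_cong)
  also have "\<dots> = (\<Sum>\<mu>\<in>{\<mu>\<in>nodes N. \<forall>j. j \<noteq> l \<longrightarrow> \<mu> j = \<nu> j}. f \<mu> * ?d \<mu>)"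
    by (simp add: prod_lagrange sum.inter_filter if_distrib cong: sum.cong if_cong)
  also have "\<dots> = (\<Sum>m\<le>N. f (\<nu>(l := m)) * dmat N (\<nu> l) m)"
    by (rule sum.reindex_bij_witness[of _ "\<lambda>m. \<nu>(l := m)" "\<lambda>\<mu>. \<mu> l"])
       (use assms in \<open>auto simp: upd nodes_le nodes_upd\<close>)
  finally show ?thesis by (simp add: nodal_partial_def mult.commute)
qed

lemma nodal_partial_cong:
  "\<nu> \<in> nodes N \<Longrightarrow> (\<And>\<mu>. \<mu> \<in> nodes N \<Longrightarrow> f \<mu> = g \<mu>) \<Longrightarrow> nodal_partial N l f \<nu> = nodal_partial N l g \<nu>"
  by (simp add: nodal_partial_def nodes_upd)

lemma nodal_partial_diff:
  "nodal_partial N l (\<lambda>\<mu>. f \<mu> - g \<mu>) \<nu> = nodal_partial N l f \<nu> - nodal_partial N l g \<nu>"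
  by (simp add: nodal_partial_def right_diff_distrib sum_subtractf)

lemma nodal_partial_uminus: "nodal_partial N l (\<lambda>\<mu>. - f \<mu>) \<nu> = - nodal_partial N l f \<nu>"
  by (simp add: nodal_partial_def sum_negf)

lemma nodal_partial_commute:
  "nodal_partial N l (nodal_partial N l' f) \<nu> = nodal_partial N l' (nodal_partial N l f) \<nu>"
proof (cases "l = l'")
  case False
  have "nodal_partial N l (nodal_partial N l' f) \<nu>
      = (\<Sum>m\<le>N. \<Sum>m'\<le>N. dmat N (\<nu> l) m * (dmat N (\<nu> l') m' * f (\<nu>(l := m, l' := m'))))"
    using False by (simp add: nodal_partial_def sum_distrib_left)
  also have "\<dots> = (\<Sum>m'\<le>N. \<Sum>m\<le>N. dmat N (\<nu> l) m * (dmat N (\<nu> l') m' * f (\<nu>(l := m, l' := m'))))"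
    by (rule sum.swap)
  also have "\<dots> = nodal_partial N l' (nodal_partial N l f) \<nu>"
    using False by (simp add: nodal_partial_def sum_distrib_left fun_upd_twist[OF False] mult.left_commute)
  finally show ?thesis .
qed simp

text \<open>At the nodes the metric terms are a discrete curl, and nodal derivatives in different directions commute,
  so the discrete divergence of a discrete curl vanishes.\<close>
lemma discrete_metric_identity:
  assumes "1 \<le> N" "\<nu> \<in> nodes N"
  shows "(\<Sum>l\<in>UNIV. nodal_partial N l (\<lambda>\<mu>. metric N X \<mu> $ l $ \<alpha>) \<nu>) = 0"
proof -
  define g where "g j \<mu> = X (pt N \<mu>) $ (\<alpha> + 2) * partial j (\<lambda>x. X x $ (\<alpha> + 1)) (pt N \<mu>)" for j \<mu>
  let ?D = "nodal_partial N"
  have m: "metric N X \<mu> $ l $ \<alpha> = - (?D (l + 1) (g (l + 2)) \<mu> - ?D (l + 2) (g (l + 1)) \<mu>)"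
    if "\<mu> \<in> nodes N" for \<mu> l
    by (simp add: metric_def Let_def partial_interp[OF assms(1) that] flip: g_def)
  have "?D l (\<lambda>\<mu>. metric N X \<mu> $ l $ \<alpha>) \<nu>
      = ?D l (?D (l + 2) (g (l + 1))) \<nu> - ?D l (?D (l + 1) (g (l + 2))) \<nu>" for l
    by (subst nodal_partial_cong[OF assms(2) m])
       (simp_all add: nodal_partial_diff nodal_partial_uminus)
  \<comment> \<open>Index arithmetic in the type of three elements.\<close>
  moreover have mod3: "(4::3) = 1" "(5::3) = 2" by simp_all
  ultimately show ?thesis
    by (simp add: sum_3 mod3 nodal_partial_commute[of N 3 1] nodal_partial_commute[of N 3 2]
        nodal_partial_commute[of N 2 1])
qed

section \<open>Summation by parts on the reference cube\<close>

lemma finite_face_nodes [simp]: "finite (face_nodes N f)"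
  by (simp add: face_nodes_def)

lemma wt_split: "wt N \<nu> = lgl_weight N (\<nu> l) * face_wt N (l, b) \<nu>"
  unfolding wt_def face_wt_def by (simp add: prod.remove[of UNIV l])

lemma face_wt_upd: "face_wt N (l, b) (\<nu>(l := m)) = face_wt N (l, b') \<nu>"
  by (auto simp: face_wt_def intro!: prod.cong)

text \<open>The grid is fibred over the face \<open>(l, False)\<close> by the grid lines in direction \<open>l\<close>, on which one-dimensional
  summation by parts acts.\<close>
lemma sum_nodes_slices:
  "(\<Sum>\<nu>\<in>nodes N. h \<nu>) = (\<Sum>\<mu>\<in>face_nodes N (l, False). \<Sum>i\<le>N. h (\<mu>(l := i)))"
  unfolding sum.cartesian_product
  by (rule sum.reindex_bij_witness[of _ "\<lambda>(\<mu>, i). \<mu>(l := i)" "\<lambda>\<nu>. (\<nu>(l := 0), \<nu> l)"])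
     (auto simp: face_nodes_def nodes_def fun_eq_iff)

lemma sum_opposite_face:
  "(\<Sum>\<mu>\<in>face_nodes N (l, True). h \<mu>) = (\<Sum>\<mu>\<in>face_nodes N (l, False). h (\<mu>(l := N)))"
  by (rule sum.reindex_bij_witness[of _ "\<lambda>\<mu>. \<mu>(l := N)" "\<lambda>\<mu>. \<mu>(l := 0)"])
     (auto simp: face_nodes_def nodes_def fun_eq_iff)

lemma summation_by_parts_cube:
  assumes "1 \<le> N"
  shows "(\<Sum>\<nu>\<in>nodes N. wt N \<nu> * (\<Sum>m\<le>N. dmat N (\<nu> l) m * (S \<nu> (\<nu>(l := m)) + S (\<nu>(l := m)) \<nu>)))
    = (\<Sum>b\<in>UNIV. \<Sum>\<mu>\<in>face_nodes N (l, b). face_wt N (l, b) \<mu> * (ref_normal (l, b) $ l * S \<mu> \<mu>))"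
proof -
  have "(\<Sum>\<nu>\<in>nodes N. wt N \<nu> * (\<Sum>m\<le>N. dmat N (\<nu> l) m * (S \<nu> (\<nu>(l := m)) + S (\<nu>(l := m)) \<nu>)))
      = (\<Sum>\<mu>\<in>face_nodes N (l, False). face_wt N (l, False) \<mu> *
          (\<Sum>i\<le>N. \<Sum>m\<le>N. lgl_weight N i * dmat N i m *
            (S (\<mu>(l := i)) (\<mu>(l := m)) + S (\<mu>(l := m)) (\<mu>(l := i)))))"
    unfolding sum_nodes_slices[of _ N l] wt_split[of N _ l False] sum_distrib_left
    by (intro sum.cong refl) (simp add: face_wt_upd[of N l False _ _ False] mult_ac)
  also have "\<dots> = (\<Sum>\<mu>\<in>face_nodes N (l, False). face_wt N (l, False) \<mu> *
          (S (\<mu>(l := N)) (\<mu>(l := N)) - S (\<mu>(l := 0)) (\<mu>(l := 0))))"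
    by (simp add: summation_by_parts[OF assms, of "\<lambda>i m. S (\<mu>(l := i)) (\<mu>(l := m))" for \<mu>])
  also have "\<dots> = (\<Sum>\<mu>\<in>face_nodes N (l, False). face_wt N (l, False) \<mu> * S (\<mu>(l := N)) (\<mu>(l := N)))
      - (\<Sum>\<mu>\<in>face_nodes N (l, False). face_wt N (l, False) \<mu> * S \<mu> \<mu>)"
    by (auto simp: right_diff_distrib sum_subtractf face_nodes_def fun_upd_idem
        intro!: arg_cong2[of _ _ _ _ minus] sum.cong)
  finally show ?thesis
    by (simp add: UNIV_bool sum_opposite_face face_wt_upd[of N l True _ _ False] ref_normal_def sum_negf)
qed

section \<open>Contraction with the kinetic energy variables\<close>

lemma mean_commute: "mean a b = mean b a"
  by (simp add: mean_def add.commute)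

lemma mean_self [simp]: "mean a a = a"
  by (simp add: mean_def flip: scaleR_2)

lemma mean_nth: "mean a b $ m = mean (a $ m) (b $ m)"
  by (simp add: mean_def)

lemma mom_eq_mean_iff:
  "mom w = dens w *\<^sub>R mean va vb + axis s p \<longleftrightarrow>
    (\<forall>m. mom w $ m = mean (va $ m) (vb $ m) * dens w + (if m = s then p else 0))"
  by (auto simp: vec_eq_iff mean_nth axis_def mult.commute)

lemma kev_inner: "kev a \<bullet> w = vel a \<bullet> mom w - dens w * (vel a \<bullet> vel a) / 2"
  by (simp add: kev_def inner_prod_def dens_def mom_def power2_norm_eq_inner)

lemma kev_inner_mean:
  assumes "mom w = dens w *\<^sub>R mean (vel a) (vel b) + q"
  shows "kev a \<bullet> w = dens w * (vel a \<bullet> vel b) / 2 + vel a \<bullet> q"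
  by (simp add: kev_inner assms mean_def inner_simps algebra_simps)

text \<open>The mean velocity in \<open>w\<close> does not change when \<open>a\<close> and \<open>b\<close> are swapped, so the symmetric part drops out. This is the
  kinetic energy preservation condition at temporal interfaces (\<open>q = 0\<close>) and at spatial ones (\<open>q\<close> a pressure term).\<close>
lemma kev_jump_inner_mean:
  assumes "mom w = dens w *\<^sub>R mean (vel a) (vel b) + q"
  shows "(kev a - kev b) \<bullet> w = (vel a - vel b) \<bullet> q"
proof -
  have "mom w = dens w *\<^sub>R mean (vel b) (vel a) + q" using assms by (simp only: mean_commute)
  from kev_inner_mean[OF this] kev_inner_mean[OF assms] show ?thesis
    by (simp add: inner_diff_left inner_commute[of "vel b" "vel a"])
qed

lemma mom_eq: "0 < dens u \<Longrightarrow> mom u = dens u *\<^sub>R vel u"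
  by (simp add: vel_def)

lemma kev_inner_self:
  assumes "0 < dens u"
  shows "kev u \<bullet> u = kin u"
  using kev_inner_mean[of u u u 0] mom_eq[OF assms] by (simp add: kin_def power2_norm_eq_inner)

text \<open>Summed over the directions with the scaled normal as weights, this is the boundary term that
  summation by parts produces in the volume, see \<open>space_div_kev\<close>.\<close>
lemma kev_inner_euler_flux: "kev u \<bullet> euler_flux \<gamma> s u = (kin u + pres \<gamma> u) * vel u $ s"
proof -
  have "mom (euler_flux \<gamma> s u) = dens (euler_flux \<gamma> s u) *\<^sub>R mean (vel u) (vel u) + axis s (pres \<gamma> u)"
    by (simp add: vec_eq_iff axis_def mom_def dens_def euler_flux_def)
  from kev_inner_mean[OF this] show ?thesis
    by (simp add: inner_axis kin_def power2_norm_eq_inner algebra_simps)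
       (simp add: euler_flux_def dens_def)
qed

section \<open>The temporal part\<close>

lemma kep_time_stateD:
  assumes "kep_time_state UK" "0 < dens a" "0 < dens b"
  shows "UK a a = a" "UK a b = UK b a"
    "mom (UK a b) = dens (UK a b) *\<^sub>R mean (vel a) (vel b)"
proof -
  have "\<forall>m. mom (UK a b) $ m = mean (vel a $ m) (vel b $ m) * dens (UK a b)"
    using assms unfolding kep_time_state_def by blast
  then show "mom (UK a b) = dens (UK a b) *\<^sub>R mean (vel a) (vel b)"
    by (simp add: vec_eq_iff mean_nth mult.commute)
  show "UK a a = a" "UK a b = UK b a"
    using assms unfolding kep_time_state_def by blast+
qed

text \<open>The vanishing jump makes \<open>V \<bullet> UK\<close> symmetric in time, so the volume term is the difference of the kinetic
  energies at both ends; these cancel against \<open>V \<bullet> u\<close> in the boundary terms.\<close>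
lemma A_T_kev:
  assumes "1 \<le> M" "kep_time_state UK"
    and pos: "\<And>\<sigma> \<nu>. \<sigma> \<le> M \<Longrightarrow> \<nu> \<in> nodes N \<Longrightarrow> 0 < dens (u \<sigma> \<nu>)"
  shows "A_T N M X UK uL uR u (\<lambda>\<sigma> \<nu>. kev (u \<sigma> \<nu>))
    = (\<Sum>\<nu>\<in>nodes N. wt N \<nu> * jac N X \<nu> * (kev (u M \<nu>) \<bullet> uR \<nu> - kev (u 0 \<nu>) \<bullet> uL \<nu>))"
proof -
  have vol: "(\<Sum>\<sigma>\<le>M. lgl_weight M \<sigma> * (kev (u \<sigma> \<nu>) \<bullet> time_deriv M UK u \<sigma> \<nu>))
      = kin (u M \<nu>) - kin (u 0 \<nu>)" if \<nu>: "\<nu> \<in> nodes N" for \<nu>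
  proof -
    define S where "S \<sigma> \<theta> = kev (u \<sigma> \<nu>) \<bullet> UK (u \<sigma> \<nu>) (u \<theta> \<nu>)" for \<sigma> \<theta>
    have sym: "S \<sigma> \<theta> = S \<theta> \<sigma>" if "\<sigma> \<le> M" "\<theta> \<le> M" for \<sigma> \<theta>
    proof -
      let ?a = "u \<sigma> \<nu>" and ?b = "u \<theta> \<nu>"
      have ab: "0 < dens ?a" "0 < dens ?b" using pos that \<nu> by auto
      from kev_jump_inner_mean[of _ ?a ?b 0, unfolded add_0_right, OF kep_time_stateD(3)[OF assms(2) ab]]
      have "(kev ?a - kev ?b) \<bullet> UK ?a ?b = 0" by simp
      moreover have "UK ?a ?b = UK ?b ?a" by (rule kep_time_stateD(2)[OF assms(2) ab])
      ultimately show ?thesis by (simp add: S_def inner_diff_left)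
    qed
    have diag: "S \<sigma> \<sigma> = kin (u \<sigma> \<nu>)" if "\<sigma> \<le> M" for \<sigma>
      using kep_time_stateD(1)[OF assms(2) pos[OF that \<nu>] pos[OF that \<nu>]] pos[OF that \<nu>]
      by (simp add: S_def kev_inner_self)
    have "(\<Sum>\<sigma>\<le>M. lgl_weight M \<sigma> * (kev (u \<sigma> \<nu>) \<bullet> time_deriv M UK u \<sigma> \<nu>))
        = (\<Sum>\<sigma>\<le>M. \<Sum>\<theta>\<le>M. lgl_weight M \<sigma> * dmat M \<sigma> \<theta> * (S \<sigma> \<theta> + S \<theta> \<sigma>))"
      by (intro sum.cong refl)
         (simp add: time_deriv_def inner_sum_right sum_distrib_left S_def[symmetric] sym mult_ac)
    then show ?thesis using summation_by_parts[OF assms(1), of S] by (simp add: diag)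
  qed
  have "ip_spacetime N M (\<lambda>\<sigma> \<nu>. jac N X \<nu> *\<^sub>R time_deriv M UK u \<sigma> \<nu>) (\<lambda>\<sigma> \<nu>. kev (u \<sigma> \<nu>))
      = (\<Sum>\<nu>\<in>nodes N. wt N \<nu> * jac N X \<nu> *
          (\<Sum>\<sigma>\<le>M. lgl_weight M \<sigma> * (kev (u \<sigma> \<nu>) \<bullet> time_deriv M UK u \<sigma> \<nu>)))"
    unfolding ip_spacetime_def
    by (subst sum.swap) (simp add: sum_distrib_left inner_commute mult_ac)
  also have "\<dots> = (\<Sum>\<nu>\<in>nodes N. wt N \<nu> * jac N X \<nu> * (kin (u M \<nu>) - kin (u 0 \<nu>)))"
    by (simp add: vol)
  finally show ?thesis
    by (simp add: A_T_def ip_space_def sum_subtractf[symmetric] sum.distrib[symmetric])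
       (intro sum.cong refl, simp add: pos inner_diff_right kev_inner_self algebra_simps
          inner_commute[of _ "kev _"])
qed

section \<open>The spatial part\<close>

lemma kep_volume_fluxD:
  assumes "kep_volume_flux \<gamma> FV" "0 < dens (fst x)" "0 < dens (fst y)"
  shows "FV l s x x = euler_flux \<gamma> s (fst x)" "FV l s x y = FV l s y x"
    "mean (snd x $ l $ s) (snd y $ l $ s) \<noteq> 0 \<Longrightarrow>
      mom (FV l s x y) = dens (FV l s x y) *\<^sub>R mean (vel (fst x)) (vel (fst y)) + axis s (pstar \<gamma> l s x y)"
proof -
  show "FV l s x x = euler_flux \<gamma> s (fst x)" "FV l s x y = FV l s y x"
    using assms unfolding kep_volume_flux_def by blast+
  assume "mean (snd x $ l $ s) (snd y $ l $ s) \<noteq> 0"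
  then show "mom (FV l s x y)
      = dens (FV l s x y) *\<^sub>R mean (vel (fst x)) (vel (fst y)) + axis s (pstar \<gamma> l s x y)"
    using assms unfolding mom_eq_mean_iff kep_volume_flux_def by blast
qed

lemma vol_product_commute:
  assumes "kep_volume_flux \<gamma> FV" "0 < dens (fst x)" "0 < dens (fst y)"
  shows "vol_product \<gamma> FV l s x y = vol_product \<gamma> FV l s y x"
  using kep_volume_fluxD(2)[OF assms, of l s] by (simp add: vol_product_def mean_commute Let_def)

text \<open>Multiplied by the metric mean, the pressure term of the flux loses its denominator and becomes bilinear in
  pressure and metric terms. A vanishing metric mean is no exception, because the
  product is then read as exactly this expression.\<close>
lemma mom_vol_product:
  assumes "kep_volume_flux \<gamma> FV" "0 < dens a" "0 < dens b"
  shows "mom (vol_product \<gamma> FV l s (a, A) (b, B))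
    = dens (vol_product \<gamma> FV l s (a, A) (b, B)) *\<^sub>R mean (vel a) (vel b)
      + axis s ((pres \<gamma> a * B $ l $ s + pres \<gamma> b * A $ l $ s) / 2)"
proof -
  let ?c = "mean (A $ l $ s) (B $ l $ s)" and ?F = "FV l s (a, A) (b, B)"
  have cancel: "2 * mean (pres \<gamma> a) (pres \<gamma> b) * ?c - mean (pres \<gamma> a * A $ l $ s) (pres \<gamma> b * B $ l $ s)
      = (pres \<gamma> a * B $ l $ s + pres \<gamma> b * A $ l $ s) / 2"
    by (simp add: mean_def field_simps)
  show ?thesis
  proof (cases "?c = 0")
    case True
    then show ?thesis unfolding cancel[symmetric] by (simp add: vol_product_def mom_def dens_def)
  next
    case False
    have "mom ?F = dens ?F *\<^sub>R mean (vel a) (vel b) + axis s (pstar \<gamma> l s (a, A) (b, B))"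
      using kep_volume_fluxD(3)[OF assms(1), of "(a, A)" "(b, B)" l s] assms False by simp
    then have "?c *\<^sub>R mom ?F = (?c * dens ?F) *\<^sub>R mean (vel a) (vel b)
        + axis s (?c * pstar \<gamma> l s (a, A) (b, B))"
      by (simp add: vec_eq_iff axis_def algebra_simps)
    moreover have "?c * pstar \<gamma> l s (a, A) (b, B)
        = (pres \<gamma> a * B $ l $ s + pres \<gamma> b * A $ l $ s) / 2"
      using False unfolding cancel[symmetric] by (simp add: pstar_def right_diff_distrib)
    ultimately show ?thesis using False by (simp add: vol_product_def Let_def mom_def dens_def)
  qed
qed

lemma dens_vol_product_self:
  assumes "kep_volume_flux \<gamma> FV" "0 < dens a"
  shows "dens (vol_product \<gamma> FV l s (a, A) (a, A)) = A $ l $ s * dens a * vel a $ s"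
  using kep_volume_fluxD(1)[OF assms(1), of "(a, A)" "(a, A)" l s] assms(2)
  by (simp add: vol_product_def Let_def dens_def euler_flux_def)

text \<open>On the face \<open>(l, b)\<close> the reference normal has only its \<open>l\<close>-th component.\<close>
lemma scaled_normal_inner_vel:
  "scaled_normal N X (l, b) \<nu> \<bullet> vel (u \<nu>) = ref_normal (l, b) $ l * contra_vel N X u l \<nu>"
proof -
  have "scaled_normal N X (l, b) \<nu> = ref_normal (l, b) $ l *\<^sub>R metric N X \<nu> $ l"
    unfolding scaled_normal_def
    by (subst sum.remove[of UNIV l]) (auto simp: ref_normal_def axis_def intro!: sum.neutral)
  then show ?thesis by (simp add: contra_vel_def inner_commute)
qed

text \<open>The two-point term \<open>S\<close> in the proof collects half the convective part, which is symmetric, and the contravariant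
  velocity at the first node times the pressure at the second. Its symmetrization is, up to the
  metric identities, the work of the flux divergence plus pressure times velocity divergence,
  and its diagonal is the energy flux \<open>(\<kappa> + p) v\<close> in contravariant form.\<close>
lemma space_div_kev:
  assumes N: "1 \<le> N" and FV: "kep_volume_flux \<gamma> FV"
    and pos: "\<And>\<nu>. \<nu> \<in> nodes N \<Longrightarrow> 0 < dens (u \<nu>)"
  shows "(\<Sum>\<nu>\<in>nodes N. wt N \<nu> * (space_div \<gamma> N X FV u \<nu> \<bullet> kev (u \<nu>)))
    = (\<Sum>f\<in>UNIV. \<Sum>\<nu>\<in>face_nodes N f. face_wt N f \<nu> *
         ((kin (u \<nu>) + pres \<gamma> (u \<nu>)) * (scaled_normal N X f \<nu> \<bullet> vel (u \<nu>))))
      - (\<Sum>\<nu>\<in>nodes N. wt N \<nu> * (div_contra_vel N X u \<nu> * pres \<gamma> (u \<nu>)))"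
proof -
  define a where "a \<nu> = metric N X \<nu>" for \<nu>
  define p where "p \<nu> = pres \<gamma> (u \<nu>)" for \<nu>
  define W where "W l s \<nu> \<mu> = vol_product \<gamma> FV l s (u \<nu>, a \<nu>) (u \<mu>, a \<mu>)" for l s \<nu> \<mu>
  define K where "K l \<nu> \<mu> = (\<Sum>s\<in>UNIV. dens (W l s \<nu> \<mu>)) * (vel (u \<nu>) \<bullet> vel (u \<mu>))" for l \<nu> \<mu>
  define S where "S l \<nu> \<mu> = K l \<nu> \<mu> / 2 + contra_vel N X u l \<nu> * p \<mu>" for l \<nu> \<mu>
  have K_sym: "K l \<nu> \<mu> = K l \<mu> \<nu>" if "\<nu> \<in> nodes N" "\<mu> \<in> nodes N" for l \<nu> \<mu>
    using vol_product_commute[OF FV, of "(u \<nu>, a \<nu>)" "(u \<mu>, a \<mu>)"] pos that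
    by (simp add: K_def W_def inner_commute)
  have cv: "contra_vel N X u l \<nu> = (\<Sum>s\<in>UNIV. a \<nu> $ l $ s * vel (u \<nu>) $ s)" for l \<nu>
    by (simp add: contra_vel_def a_def inner_vec_def mult.commute)
  have S_diag: "S l \<nu> \<nu> = (kin (u \<nu>) + p \<nu>) * contra_vel N X u l \<nu>" if "\<nu> \<in> nodes N" for l \<nu>
  proof -
    have "K l \<nu> \<nu> = 2 * kin (u \<nu>) * contra_vel N X u l \<nu>"
      using dens_vol_product_self[OF FV pos[OF that]]
      by (simp add: K_def W_def cv kin_def power2_norm_eq_inner sum_distrib_left sum_distrib_right mult_ac)
    then show ?thesis by (simp add: S_def algebra_simps)
  qed
  have kev_W: "2 * (\<Sum>s\<in>UNIV. kev (u \<nu>) \<bullet> W l s \<nu> \<mu>)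
      = K l \<nu> \<mu> + contra_vel N X u l \<nu> * p \<mu> + (\<Sum>s\<in>UNIV. p \<nu> * vel (u \<nu>) $ s * a \<mu> $ l $ s)"
    if "\<nu> \<in> nodes N" "\<mu> \<in> nodes N" for l \<nu> \<mu>
  proof -
    have "2 * (kev (u \<nu>) \<bullet> W l s \<nu> \<mu>) = dens (W l s \<nu> \<mu>) * (vel (u \<nu>) \<bullet> vel (u \<mu>))
        + a \<nu> $ l $ s * vel (u \<nu>) $ s * p \<mu> + p \<nu> * vel (u \<nu>) $ s * a \<mu> $ l $ s" for s
      using kev_inner_mean[OF mom_vol_product[OF FV pos[OF that(1)] pos[OF that(2)]], of l s "a \<nu>" "a \<mu>"]
      by (simp add: W_def p_def inner_axis field_simps)
    then show ?thesis
      by (simp add: sum_distrib_left K_def cv sum.distrib sum_distrib_right)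
  qed
  have point: "space_div \<gamma> N X FV u \<nu> \<bullet> kev (u \<nu>) + div_contra_vel N X u \<nu> * p \<nu>
      = (\<Sum>l\<in>UNIV. \<Sum>m\<le>N. dmat N (\<nu> l) m * (S l \<nu> (\<nu>(l := m)) + S l (\<nu>(l := m)) \<nu>))"
    if \<nu>: "\<nu> \<in> nodes N" for \<nu>
  proof -
    let ?D = "\<lambda>l m. dmat N (\<nu> l) m" and ?v = "vel (u \<nu>)"
    have "space_div \<gamma> N X FV u \<nu> \<bullet> kev (u \<nu>)
        = (\<Sum>m\<le>N. \<Sum>s\<in>UNIV. \<Sum>l\<in>UNIV. ?D l m * (2 * (kev (u \<nu>) \<bullet> W l s \<nu> (\<nu>(l := m)))))"
      by (subst inner_commute)
         (simp add: space_div_def inner_sum_right W_def a_def sum_distrib_left mult_ac)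
    also have "\<dots> = (\<Sum>m\<le>N. \<Sum>l\<in>UNIV. ?D l m * (2 * (\<Sum>s\<in>UNIV. kev (u \<nu>) \<bullet> W l s \<nu> (\<nu>(l := m)))))"
      unfolding sum_distrib_left by (intro sum.cong refl sum.swap)
    also have "\<dots> = (\<Sum>l\<in>UNIV. \<Sum>m\<le>N. ?D l m * (2 * (\<Sum>s\<in>UNIV. kev (u \<nu>) \<bullet> W l s \<nu> (\<nu>(l := m)))))"
      by (rule sum.swap)
    also have "\<dots> = (\<Sum>l\<in>UNIV. \<Sum>m\<le>N. ?D l m * (K l \<nu> (\<nu>(l := m)) + contra_vel N X u l \<nu> * p (\<nu>(l := m))))
        + (\<Sum>l\<in>UNIV. \<Sum>m\<le>N. ?D l m * (\<Sum>s\<in>UNIV. p \<nu> * ?v $ s * a (\<nu>(l := m)) $ l $ s))"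
      by (simp add: kev_W \<nu> nodes_upd distrib_left sum.distrib)
    also have "(\<Sum>l\<in>UNIV. \<Sum>m\<le>N. ?D l m * (\<Sum>s\<in>UNIV. p \<nu> * ?v $ s * a (\<nu>(l := m)) $ l $ s))
        = (\<Sum>l\<in>UNIV. \<Sum>s\<in>UNIV. p \<nu> * ?v $ s * nodal_partial N l (\<lambda>\<mu>. a \<mu> $ l $ s) \<nu>)"
      unfolding nodal_partial_def sum_distrib_left
      by (subst sum.swap[of _ UNIV "{..N}"]) (simp add: mult_ac)
    also have "\<dots> = (\<Sum>s\<in>UNIV. p \<nu> * ?v $ s * (\<Sum>l\<in>UNIV. nodal_partial N l (\<lambda>\<mu>. a \<mu> $ l $ s) \<nu>))"
      unfolding sum_distrib_left by (rule sum.swap)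
    \<comment> \<open>The part of the pressure term with the pressure at \<open>\<nu>\<close> itself is a free-stream term.\<close>
    also have "\<dots> = 0"
      by (simp add: a_def discrete_metric_identity[OF N \<nu>])
    finally have "space_div \<gamma> N X FV u \<nu> \<bullet> kev (u \<nu>)
        = (\<Sum>l\<in>UNIV. \<Sum>m\<le>N. ?D l m * (K l \<nu> (\<nu>(l := m)) + contra_vel N X u l \<nu> * p (\<nu>(l := m))))"
      by (simp add: fun_upd_def)
    moreover have "div_contra_vel N X u \<nu> * p \<nu>
        = (\<Sum>l\<in>UNIV. \<Sum>m\<le>N. ?D l m * (contra_vel N X u l (\<nu>(l := m)) * p \<nu>))"
      by (simp add: div_contra_vel_def partial_interp[OF N \<nu>] nodal_partial_def sum_distrib_right mult.assoc)
    moreover have "S l \<nu> (\<nu>(l := m)) + S l (\<nu>(l := m)) \<nu>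
        = K l \<nu> (\<nu>(l := m)) + contra_vel N X u l \<nu> * p (\<nu>(l := m))
          + contra_vel N X u l (\<nu>(l := m)) * p \<nu>" if "m \<le> N" for l m
      using K_sym[OF nodes_upd[OF \<nu> that] \<nu>] by (simp add: S_def)
    ultimately show ?thesis
      by (simp add: distrib_left sum.distrib)
  qed
  have "(\<Sum>\<nu>\<in>nodes N. wt N \<nu> * (space_div \<gamma> N X FV u \<nu> \<bullet> kev (u \<nu>)))
      + (\<Sum>\<nu>\<in>nodes N. wt N \<nu> * (div_contra_vel N X u \<nu> * p \<nu>))
      = (\<Sum>\<nu>\<in>nodes N. \<Sum>l\<in>UNIV. wt N \<nu> *
          (\<Sum>m\<le>N. dmat N (\<nu> l) m * (S l \<nu> (\<nu>(l := m)) + S l (\<nu>(l := m)) \<nu>)))"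
    by (simp add: sum.distrib[symmetric] distrib_left[symmetric] point sum_distrib_left)
  also have "\<dots> = (\<Sum>l\<in>UNIV. \<Sum>b\<in>UNIV. \<Sum>\<nu>\<in>face_nodes N (l, b).
      face_wt N (l, b) \<nu> * (ref_normal (l, b) $ l * S l \<nu> \<nu>))"
    by (subst sum.swap) (simp only: summation_by_parts_cube[OF N])
  also have "\<dots> = (\<Sum>l\<in>UNIV. \<Sum>b\<in>UNIV. \<Sum>\<nu>\<in>face_nodes N (l, b). face_wt N (l, b) \<nu> *
      ((kin (u \<nu>) + p \<nu>) * (scaled_normal N X (l, b) \<nu> \<bullet> vel (u \<nu>))))"
    by (intro sum.cong refl) (auto simp: scaled_normal_inner_vel S_diag face_nodes_def)
  also have "\<dots> = (\<Sum>f\<in>UNIV. \<Sum>\<nu>\<in>face_nodes N f. face_wt N f \<nu> *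
      ((kin (u \<nu>) + p \<nu>) * (scaled_normal N X f \<nu> \<bullet> vel (u \<nu>))))"
    by (simp add: sum.cartesian_product)
  finally show ?thesis by (simp add: p_def)
qed

text \<open>The boundary terms of \<open>space_div_kev\<close> are exactly the work of the interior flux that the surface integral
  subtracts.\<close>
lemma A_S_kev:
  assumes "1 \<le> N" "kep_volume_flux \<gamma> FV"
    and pos: "\<And>\<sigma> \<nu>. \<sigma> \<le> M \<Longrightarrow> \<nu> \<in> nodes N \<Longrightarrow> 0 < dens (u \<sigma> \<nu>)"
  shows "A_S \<gamma> N M X FV \<Delta>t fstar u (\<lambda>\<sigma> \<nu>. kev (u \<sigma> \<nu>))
    = \<Delta>t / 2 * (\<Sum>f\<in>UNIV. face_integral N M f (\<lambda>\<sigma> \<nu>. kev (u \<sigma> \<nu>) \<bullet> fstar f \<sigma> \<nu>))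
      - \<Delta>t / 2 * ip_spacetime N M (\<lambda>\<sigma>. div_contra_vel N X (u \<sigma>)) (\<lambda>\<sigma> \<nu>. pres \<gamma> (u \<sigma> \<nu>))"
proof -
  define G where "G f \<sigma> \<nu> = (kin (u \<sigma> \<nu>) + pres \<gamma> (u \<sigma> \<nu>)) * (scaled_normal N X f \<nu> \<bullet> vel (u \<sigma> \<nu>))"
    for f \<sigma> \<nu>
  have "ip_spacetime N M (\<lambda>\<sigma>. space_div \<gamma> N X FV (u \<sigma>)) (\<lambda>\<sigma> \<nu>. kev (u \<sigma> \<nu>))
      = (\<Sum>\<sigma>\<le>M. lgl_weight M \<sigma> *
          (\<Sum>\<nu>\<in>nodes N. wt N \<nu> * (space_div \<gamma> N X FV (u \<sigma>) \<nu> \<bullet> kev (u \<sigma> \<nu>))))"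
    by (simp add: ip_spacetime_def sum_distrib_left mult.assoc)
  also have "\<dots> = (\<Sum>\<sigma>\<le>M. lgl_weight M \<sigma> * (\<Sum>f\<in>UNIV. \<Sum>\<nu>\<in>face_nodes N f. face_wt N f \<nu> * G f \<sigma> \<nu>))
      - ip_spacetime N M (\<lambda>\<sigma>. div_contra_vel N X (u \<sigma>)) (\<lambda>\<sigma> \<nu>. pres \<gamma> (u \<sigma> \<nu>))"
    by (simp add: space_div_kev[OF assms(1,2)] pos G_def right_diff_distrib sum_subtractf
        ip_spacetime_def sum_distrib_left mult.assoc)
  also have "(\<Sum>\<sigma>\<le>M. lgl_weight M \<sigma> * (\<Sum>f\<in>UNIV. \<Sum>\<nu>\<in>face_nodes N f. face_wt N f \<nu> * G f \<sigma> \<nu>))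
      = (\<Sum>f\<in>UNIV. face_integral N M f (G f))"
    unfolding sum_distrib_left face_integral_def
    by (subst sum.swap, intro sum.cong refl, subst sum.swap) (simp add: mult_ac)
  finally have vol: "ip_spacetime N M (\<lambda>\<sigma>. space_div \<gamma> N X FV (u \<sigma>)) (\<lambda>\<sigma> \<nu>. kev (u \<sigma> \<nu>))
      = (\<Sum>f\<in>UNIV. face_integral N M f (G f))
        - ip_spacetime N M (\<lambda>\<sigma>. div_contra_vel N X (u \<sigma>)) (\<lambda>\<sigma> \<nu>. pres \<gamma> (u \<sigma> \<nu>))" .
  have flux: "kev (u \<sigma> \<nu>) \<bullet> (\<Sum>m\<in>UNIV. scaled_normal N X f \<nu> $ m *\<^sub>R euler_flux \<gamma> m (u \<sigma> \<nu>)) = G f \<sigma> \<nu>"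
    for f \<sigma> \<nu>
    by (simp add: inner_sum_right kev_inner_euler_flux G_def inner_vec_def sum_distrib_left mult_ac)
  have surf: "(\<Sum>f\<in>UNIV. face_integral N M f (\<lambda>\<sigma> \<nu>. kev (u \<sigma> \<nu>) \<bullet> (fstar f \<sigma> \<nu>
          - (\<Sum>m\<in>UNIV. scaled_normal N X f \<nu> $ m *\<^sub>R euler_flux \<gamma> m (u \<sigma> \<nu>)))))
      = (\<Sum>f\<in>UNIV. face_integral N M f (\<lambda>\<sigma> \<nu>. kev (u \<sigma> \<nu>) \<bullet> fstar f \<sigma> \<nu>))
        - (\<Sum>f\<in>UNIV. face_integral N M f (G f))"
    by (simp add: inner_diff_right flux face_integral_def right_diff_distrib sum_subtractf)
  show ?thesis unfolding A_S_def vol surf by (simp add: right_diff_distrib)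
qed

section \<open>Interfaces\<close>

lemma sum_elem_faces:
  "(\<Sum>k=1..num_elems \<M>. \<Sum>f\<in>UNIV. h k f) = (\<Sum>F\<in>elem_faces \<M>. h (fst F) (snd F))"
  by (simp add: elem_faces_def sum.cartesian_product case_prod_unfold)

lemma interface_okD:
  assumes "interface_ok N \<M> F"
  shows "nbr \<M> F \<in> elem_faces \<M>" "nbr \<M> (nbr \<M> F) = F"
    "F \<in> minus_sides \<M> \<longleftrightarrow> nbr \<M> F \<notin> minus_sides \<M>"
    "square_symmetry N (snd F) (snd (nbr \<M> F)) (glue \<M> F)"
    "\<And>\<nu>. \<nu> \<in> face_nodes N (snd F) \<Longrightarrow> glue \<M> (nbr \<M> F) (glue \<M> F \<nu>) = \<nu>"
    "\<And>\<nu>. \<nu> \<in> face_nodes N (snd F) \<Longrightarrow>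
      scaled_normal N (chart \<M> (fst (nbr \<M> F))) (snd (nbr \<M> F)) (glue \<M> F \<nu>)
        = - scaled_normal N (chart \<M> (fst F)) (snd F) \<nu>"
  using assms unfolding interface_ok_def Let_def by blast+

lemma square_symmetry_face_nodes:
  "square_symmetry N f f' g \<Longrightarrow> \<nu> \<in> face_nodes N f \<Longrightarrow> g \<nu> \<in> face_nodes N f'"
  unfolding square_symmetry_def by blast

text \<open>The identification of nodes permutes or reverses the tangential directions, and the weights are
  invariant under reversal.\<close>
lemma square_symmetry_face_wt:
  assumes "1 \<le> N" "square_symmetry N f f' g" "\<nu> \<in> face_nodes N f"
  shows "face_wt N f' (g \<nu>) = face_wt N f \<nu>"
proof -
  obtain \<pi> rev where \<pi>: "bij_betw \<pi> (UNIV - {fst f}) (UNIV - {fst f'})"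
    and g: "\<And>j. j \<in> UNIV - {fst f} \<Longrightarrow> g \<nu> (\<pi> j) = (if rev j then N - \<nu> j else \<nu> j)"
    using assms(2,3) unfolding square_symmetry_def by blast
  have le: "\<nu> j \<le> N" for j using assms(3) by (simp add: face_nodes_def nodes_le)
  have "face_wt N f' (g \<nu>) = (\<Prod>j\<in>UNIV - {fst f}. lgl_weight N (g \<nu> (\<pi> j)))"
    unfolding face_wt_def by (rule prod.reindex_bij_betw[OF \<pi>, symmetric])
  also have "\<dots> = face_wt N f \<nu>"
    unfolding face_wt_def
    by (intro prod.cong refl) (simp add: g lgl_weight_reflect[OF assms(1) le])
  finally show ?thesis .
qed

lemma face_integral_nbr:
  assumes "1 \<le> N" "interface_ok N \<M> F" "interface_ok N \<M> (nbr \<M> F)"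
  shows "face_integral N M (snd (nbr \<M> F)) g
    = face_integral N M (snd F) (\<lambda>\<sigma> \<nu>. g \<sigma> (glue \<M> F \<nu>))"
proof -
  note ok = interface_okD[OF assms(2)] and ok' = interface_okD[OF assms(3)]
  have "(\<Sum>\<nu>\<in>face_nodes N (snd (nbr \<M> F)). \<Sum>\<sigma>\<le>M. face_wt N (snd (nbr \<M> F)) \<nu> * lgl_weight M \<sigma> * g \<sigma> \<nu>)
      = (\<Sum>\<nu>\<in>face_nodes N (snd F). \<Sum>\<sigma>\<le>M. face_wt N (snd F) \<nu> * lgl_weight M \<sigma> * g \<sigma> (glue \<M> F \<nu>))"
  proof (rule sum.reindex_bij_witness[of _ "glue \<M> F" "glue \<M> (nbr \<M> F)"])
    fix \<nu> assume \<nu>: "\<nu> \<in> face_nodes N (snd (nbr \<M> F))"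
    show inv: "glue \<M> F (glue \<M> (nbr \<M> F) \<nu>) = \<nu>" using ok'(5)[OF \<nu>] ok(2) by simp
    show mem: "glue \<M> (nbr \<M> F) \<nu> \<in> face_nodes N (snd F)"
      using square_symmetry_face_nodes[OF ok'(4) \<nu>] ok(2) by simp
    show "(\<Sum>\<sigma>\<le>M. face_wt N (snd F) (glue \<M> (nbr \<M> F) \<nu>) * lgl_weight M \<sigma> * g \<sigma> (glue \<M> F (glue \<M> (nbr \<M> F) \<nu>)))
        = (\<Sum>\<sigma>\<le>M. face_wt N (snd (nbr \<M> F)) \<nu> * lgl_weight M \<sigma> * g \<sigma> \<nu>)"
      using square_symmetry_face_wt[OF assms(1) ok'(4) \<nu>] ok(2) inv by simp
  next
    fix \<nu> assume \<nu>: "\<nu> \<in> face_nodes N (snd F)"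
    show "glue \<M> (nbr \<M> F) (glue \<M> F \<nu>) = \<nu>" by (rule ok(5)[OF \<nu>])
    show "glue \<M> F \<nu> \<in> face_nodes N (snd (nbr \<M> F))"
      by (rule square_symmetry_face_nodes[OF ok(4) \<nu>])
  qed
  then show ?thesis by (simp add: face_integral_def)
qed

lemma kep_surface_fluxD:
  assumes "kep_surface_flux \<gamma> FS" "0 < dens a" "0 < dens b"
  shows "FS s a b = FS s b a"
    "mom (FS s a b) = dens (FS s a b) *\<^sub>R mean (vel a) (vel b) + axis s (mean (pres \<gamma> a) (pres \<gamma> b))"
  using assms unfolding mom_eq_mean_iff kep_surface_flux_def by blast+

text \<open>Both sides use the same two-point flux, by symmetry, with opposite normals. So the jump of the kinetic
  energy variables is tested with the flux, and only the mean pressure remains.\<close>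
lemma surface_flux_kev:
  assumes FS: "kep_surface_flux \<gamma> FS"
    and ok: "interface_ok N \<M> F" and \<nu>: "\<nu> \<in> face_nodes N (snd F)"
    and pos: "0 < dens (w (fst F) \<sigma> \<nu>)" "0 < dens (w (fst (nbr \<M> F)) \<sigma> (glue \<M> F \<nu>))"
  shows "kev (w (fst F) \<sigma> \<nu>) \<bullet> surface_flux N \<M> FS w (fst F) (snd F) \<sigma> \<nu>
    + kev (w (fst (nbr \<M> F)) \<sigma> (glue \<M> F \<nu>)) \<bullet>
        surface_flux N \<M> FS w (fst (nbr \<M> F)) (snd (nbr \<M> F)) \<sigma> (glue \<M> F \<nu>)
    = - interface_work \<gamma> N \<M> w F \<sigma> \<nu>"
proof -
  note okD = interface_okD[OF ok]
  define a where "a = w (fst F) \<sigma> \<nu>"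
  define b where "b = w (fst (nbr \<M> F)) \<sigma> (glue \<M> F \<nu>)"
  define n where "n = scaled_normal N (chart \<M> (fst F)) (snd F) \<nu>"
  have ab: "0 < dens a" "0 < dens b" using pos by (simp_all add: a_def b_def)
  have minus: "surface_flux N \<M> FS w (fst F) (snd F) \<sigma> \<nu> = (\<Sum>s\<in>UNIV. n $ s *\<^sub>R FS s b a)"
    by (simp add: surface_flux_def n_def a_def[symmetric] b_def[symmetric] kep_surface_fluxD(1)[OF FS ab])
  have plus: "surface_flux N \<M> FS w (fst (nbr \<M> F)) (snd (nbr \<M> F)) \<sigma> (glue \<M> F \<nu>)
      = - (\<Sum>s\<in>UNIV. n $ s *\<^sub>R FS s b a)"
    by (simp add: surface_flux_def okD(2) okD(5,6)[OF \<nu>] n_def sum_negf a_def[symmetric] b_def[symmetric])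
  have "(kev b - kev a) \<bullet> (\<Sum>s\<in>UNIV. n $ s *\<^sub>R FS s b a)
      = (\<Sum>s\<in>UNIV. n $ s * ((vel b - vel a) $ s * mean (pres \<gamma> b) (pres \<gamma> a)))"
    unfolding inner_sum_right inner_scaleR_right
      kev_jump_inner_mean[OF kep_surface_fluxD(2)[OF FS ab(2,1)]] by (simp add: inner_axis)
  also have "\<dots> = mean (pres \<gamma> b) (pres \<gamma> a) * (n \<bullet> (vel b - vel a))"
    unfolding inner_vec_def inner_real_def sum_distrib_left
    by (intro sum.cong refl) (simp only: mult_ac)
  also have "\<dots> = interface_work \<gamma> N \<M> w F \<sigma> \<nu>"
    by (simp add: interface_work_def Let_def a_def b_def n_def)
  finally show ?thesis
    unfolding minus plus by (simp add: a_def b_def inner_diff_left)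
qed

lemma sum_surface_flux_kev:
  assumes FS: "kep_surface_flux \<gamma> FS" and N: "1 \<le> N" and mesh: "periodic_mesh N \<M>"
    and pos: "\<And>k \<sigma> \<nu>. k \<in> {1..num_elems \<M>} \<Longrightarrow> \<sigma> \<le> M \<Longrightarrow> \<nu> \<in> nodes N \<Longrightarrow> 0 < dens (w k \<sigma> \<nu>)"
  shows "(\<Sum>k=1..num_elems \<M>. \<Sum>f\<in>UNIV.
      face_integral N M f (\<lambda>\<sigma> \<nu>. kev (w k \<sigma> \<nu>) \<bullet> surface_flux N \<M> FS w k f \<sigma> \<nu>))
    = - (\<Sum>F\<in>minus_sides \<M>. face_integral N M (snd F) (interface_work \<gamma> N \<M> w F))"
proof -
  have ok: "interface_ok N \<M> F" if "F \<in> elem_faces \<M>" for F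
    using mesh that by (simp add: periodic_mesh_def)
  have sub: "minus_sides \<M> \<subseteq> elem_faces \<M>" using mesh by (simp add: periodic_mesh_def)
  have fin: "finite (minus_sides \<M>)"
    by (rule finite_subset[OF sub]) (simp add: elem_faces_def)
  note okD = interface_okD[OF ok]
  have split: "elem_faces \<M> = minus_sides \<M> \<union> nbr \<M> ` minus_sides \<M>"
  proof
    show "elem_faces \<M> \<subseteq> minus_sides \<M> \<union> nbr \<M> ` minus_sides \<M>"
    proof
      fix F assume F: "F \<in> elem_faces \<M>"
      show "F \<in> minus_sides \<M> \<union> nbr \<M> ` minus_sides \<M>"
        using okD(3)[OF F] imageI[of "nbr \<M> F" "minus_sides \<M>" "nbr \<M>"] okD(2)[OF F] by auto
    qed
  qed (use sub okD(1) in auto)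
  have disj: "minus_sides \<M> \<inter> nbr \<M> ` minus_sides \<M> = {}"
    using sub okD(3) by blast
  have inj: "inj_on (nbr \<M>) (minus_sides \<M>)"
    by (rule inj_on_inverseI[of _ "nbr \<M>"]) (use sub okD(2) in blast)
  define h where "h F = face_integral N M (snd F)
      (\<lambda>\<sigma> \<nu>. kev (w (fst F) \<sigma> \<nu>) \<bullet> surface_flux N \<M> FS w (fst F) (snd F) \<sigma> \<nu>)" for F
  have pair: "h F + h (nbr \<M> F) = - face_integral N M (snd F) (interface_work \<gamma> N \<M> w F)"
    if "F \<in> minus_sides \<M>" for F
  proof -
    have F: "F \<in> elem_faces \<M>" using that sub by blast
    have F': "nbr \<M> F \<in> elem_faces \<M>" by (rule okD(1)[OF F])
    have "h F + h (nbr \<M> F) = face_integral N M (snd F) (\<lambda>\<sigma> \<nu>. - interface_work \<gamma> N \<M> w F \<sigma> \<nu>)"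
      unfolding h_def face_integral_nbr[OF N ok[OF F] ok[OF F']]
      unfolding face_integral_def sum.distrib[symmetric] distrib_left[symmetric]
    proof (intro sum.cong refl arg_cong2[of _ _ _ _ times])
      fix \<nu> \<sigma> assume \<nu>: "\<nu> \<in> face_nodes N (snd F)" and \<sigma>: "\<sigma> \<in> {..M}"
      have "glue \<M> F \<nu> \<in> face_nodes N (snd (nbr \<M> F))"
        by (rule square_symmetry_face_nodes[OF okD(4)[OF F] \<nu>])
      then have "\<nu> \<in> nodes N" "glue \<M> F \<nu> \<in> nodes N" using \<nu> by (auto simp: face_nodes_def)
      moreover have "fst F \<in> {1..num_elems \<M>}" "fst (nbr \<M> F) \<in> {1..num_elems \<M>}"
        using F F' by (auto simp: elem_faces_def)
      ultimately show "kev (w (fst F) \<sigma> \<nu>) \<bullet> surface_flux N \<M> FS w (fst F) (snd F) \<sigma> \<nu>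
          + kev (w (fst (nbr \<M> F)) \<sigma> (glue \<M> F \<nu>)) \<bullet>
            surface_flux N \<M> FS w (fst (nbr \<M> F)) (snd (nbr \<M> F)) \<sigma> (glue \<M> F \<nu>)
          = - interface_work \<gamma> N \<M> w F \<sigma> \<nu>"
        using \<sigma> by (intro surface_flux_kev[OF FS ok[OF F] \<nu>] pos) auto
    qed
    then show ?thesis by (simp add: face_integral_def sum_negf)
  qed
  have "(\<Sum>k=1..num_elems \<M>. \<Sum>f\<in>UNIV.
      face_integral N M f (\<lambda>\<sigma> \<nu>. kev (w k \<sigma> \<nu>) \<bullet> surface_flux N \<M> FS w k f \<sigma> \<nu>))
      = (\<Sum>F\<in>elem_faces \<M>. h F)"
    unfolding sum_elem_faces h_def ..
  also have "\<dots> = (\<Sum>F\<in>minus_sides \<M>. h F + h (nbr \<M> F))"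
    unfolding split by (simp add: sum.union_disjoint fin disj sum.reindex[OF inj] sum.distrib)
  finally show ?thesis by (simp add: pair sum_negf)
qed

section \<open>Kinetic energy preservation\<close>

text \<open>\<open>R n\<close> and \<open>L n\<close> are contributions of slab \<open>n\<close> at its end and its start.\<close>
lemma telescope_interfaces:
  fixes R L :: "nat \<Rightarrow> real"
  assumes "1 \<le> K" "\<And>n. n \<in> {1..<K} \<Longrightarrow> L (n + 1) = R n"
  shows "(\<Sum>n=1..K. R n - L n) = R K - L 1"
  using assms
proof (induction K rule: nat_induct_at_least)
  case (Suc K)
  then have "L (Suc K) = R K" "(\<Sum>n=1..K. R n - L n) = R K - L 1" by auto
  then show ?case using Suc.hyps by simp
qed simp

theorem theorem4:
  fixes \<gamma> T :: real and N M KT :: nat and dt :: "nat \<Rightarrow> real" and \<M> :: hex_mesh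
    and UK :: "state \<Rightarrow> state \<Rightarrow> state" and FV :: volume_flux
    and FS :: "3 \<Rightarrow> state \<Rightarrow> state \<Rightarrow> state"
    and u0 :: "nat \<Rightarrow> node \<Rightarrow> state"
    and Ustar :: "nat \<Rightarrow> nat \<Rightarrow> node \<Rightarrow> state"
    and U :: "nat \<Rightarrow> nat \<Rightarrow> nat \<Rightarrow> node \<Rightarrow> state"
  assumes degrees: "1 \<le> N" "1 \<le> M"
    and time_grid: "1 \<le> KT" "\<And>n. n \<in> {1..KT} \<Longrightarrow> 0 < dt n" "(\<Sum>n=1..KT. dt n) = T"
    and mesh: "periodic_mesh N \<M>"
    and time_state: "kep_time_state UK"
    and volume: "kep_volume_flux \<gamma> FV"
    and surface: "kep_surface_flux \<gamma> FS"
    and solution: "dgsem_solution \<gamma> N M KT dt \<M> UK FV FS Ustar U"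
    and dens_pos: "\<And>n k \<sigma> \<nu>. n \<in> {1..KT} \<Longrightarrow> k \<in> {1..num_elems \<M>} \<Longrightarrow> \<sigma> \<le> M \<Longrightarrow> \<nu> \<in> nodes N \<Longrightarrow>
      0 < dens (U n k \<sigma> \<nu>)"
    and dens0_pos: "\<And>k \<nu>. k \<in> {1..num_elems \<M>} \<Longrightarrow> \<nu> \<in> nodes N \<Longrightarrow> 0 < dens (u0 k \<nu>)"
    and Ustar_initial: "\<And>k \<nu>. k \<in> {1..num_elems \<M>} \<Longrightarrow> \<nu> \<in> nodes N \<Longrightarrow> Ustar 0 k \<nu> = u0 k \<nu>"
    and Ustar_final: "\<And>k \<nu>. k \<in> {1..num_elems \<M>} \<Longrightarrow> \<nu> \<in> nodes N \<Longrightarrow>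
      Ustar KT k \<nu> = U KT k M \<nu>"
    and Ustar_interior: "\<And>n k \<nu> m. n \<in> {1..<KT} \<Longrightarrow> k \<in> {1..num_elems \<M>} \<Longrightarrow> \<nu> \<in> nodes N \<Longrightarrow>
      mom (Ustar n k \<nu>) $ m
        = mean (vel (U (n + 1) k 0 \<nu>) $ m) (vel (U n k M \<nu>) $ m) * dens (Ustar n k \<nu>)"
  shows "total_kin N \<M> (\<lambda>k. U KT k M) = total_kin N \<M> u0
    + (\<Sum>n=1..KT. \<Sum>k=1..num_elems \<M>. dt n / 2 *
        ip_spacetime N M (\<lambda>\<sigma>. div_contra_vel N (chart \<M> k) (U n k \<sigma>))
          (\<lambda>\<sigma> \<nu>. pres \<gamma> (U n k \<sigma> \<nu>)))
    + (\<Sum>n=1..KT. \<Sum>F\<in>minus_sides \<M>. dt n / 2 *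
        face_integral N M (snd F) (interface_work \<gamma> N \<M> (U n) F))
    + (\<Sum>k=1..num_elems \<M>.
        ip_space N (\<lambda>\<nu>. (kev (U 1 k 0 \<nu>) - kev (u0 k \<nu>)) \<bullet> u0 k \<nu>) (jac N (chart \<M> k)))"
proof -
  let ?K = "num_elems \<M>"
  define \<phi> where "\<phi> n k \<sigma> \<nu> = kev (U n k \<sigma> \<nu>)" for n k \<sigma> \<nu>
  define AT where "AT n k = A_T N M (chart \<M> k) UK (Ustar (n - 1) k) (Ustar n k) (U n k) (\<phi> n k)" for n k
  define AS where "AS n k = A_S \<gamma> N M (chart \<M> k) FV (dt n) (surface_flux N \<M> FS (U n) k) (U n k) (\<phi> n k)"
    for n k
  define Div where "Div n k = ip_spacetime N M (\<lambda>\<sigma>. div_contra_vel N (chart \<M> k) (U n k \<sigma>))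
      (\<lambda>\<sigma> \<nu>. pres \<gamma> (U n k \<sigma> \<nu>))" for n k
  define Work where "Work n = (\<Sum>F\<in>minus_sides \<M>. face_integral N M (snd F) (interface_work \<gamma> N \<M> (U n) F))" for n
  have balance: "AT n k + AS n k = 0" if "n \<in> {1..KT}" "k \<in> {1..?K}" for n k
    using solution that unfolding dgsem_solution_def AT_def AS_def by blast

  have time: "(\<Sum>n=1..KT. AT n k) = (\<Sum>\<nu>\<in>nodes N. wt N \<nu> * jac N (chart \<M> k) \<nu> *
      (kin (U KT k M \<nu>) - kin (u0 k \<nu>) - (kev (U 1 k 0 \<nu>) - kev (u0 k \<nu>)) \<bullet> u0 k \<nu>))"
    if k: "k \<in> {1..?K}" for k
  proof -
    have AT: "AT n k = (\<Sum>\<nu>\<in>nodes N. wt N \<nu> * jac N (chart \<M> k) \<nu> *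
        (\<phi> n k M \<nu> \<bullet> Ustar n k \<nu> - \<phi> n k 0 \<nu> \<bullet> Ustar (n - 1) k \<nu>))" if "n \<in> {1..KT}" for n
      using A_T_kev[OF degrees(2) time_state, of N "U n k"] dens_pos[OF that k]
      by (simp add: AT_def \<phi>_def[abs_def])
    have point: "(\<Sum>n=1..KT. \<phi> n k M \<nu> \<bullet> Ustar n k \<nu> - \<phi> n k 0 \<nu> \<bullet> Ustar (n - 1) k \<nu>)
        = kin (U KT k M \<nu>) - kin (u0 k \<nu>) - (kev (U 1 k 0 \<nu>) - kev (u0 k \<nu>)) \<bullet> u0 k \<nu>"
      if \<nu>: "\<nu> \<in> nodes N" for \<nu>
    proof -
      \<comment> \<open>Interior temporal interfaces do not contribute.\<close>
      have "\<phi> (n + 1) k 0 \<nu> \<bullet> Ustar n k \<nu> = \<phi> n k M \<nu> \<bullet> Ustar n k \<nu>" if n: "n \<in> {1..<KT}" for n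
      proof -
        have "mom (Ustar n k \<nu>) = dens (Ustar n k \<nu>) *\<^sub>R mean (vel (U (n + 1) k 0 \<nu>)) (vel (U n k M \<nu>)) + 0"
          using Ustar_interior[OF n k \<nu>] by (simp add: vec_eq_iff mean_nth mult.commute)
        from kev_jump_inner_mean[OF this] show ?thesis by (simp add: \<phi>_def inner_diff_left)
      qed
      then have "(\<Sum>n=1..KT. \<phi> n k M \<nu> \<bullet> Ustar n k \<nu> - \<phi> n k 0 \<nu> \<bullet> Ustar (n - 1) k \<nu>)
          = \<phi> KT k M \<nu> \<bullet> Ustar KT k \<nu> - \<phi> 1 k 0 \<nu> \<bullet> Ustar 0 k \<nu>"
        using telescope_interfaces[OF time_grid(1), of "\<lambda>n. \<phi> n k 0 \<nu> \<bullet> Ustar (n - 1) k \<nu>"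
            "\<lambda>n. \<phi> n k M \<nu> \<bullet> Ustar n k \<nu>"] by simp
      also have "\<dots> = kin (U KT k M \<nu>) - kev (U 1 k 0 \<nu>) \<bullet> u0 k \<nu>"
        using dens_pos[OF _ k _ \<nu>, of KT M] time_grid(1)
        by (simp add: \<phi>_def Ustar_initial[OF k \<nu>] Ustar_final[OF k \<nu>] kev_inner_self)
      \<comment> \<open>At the initial interface \<open>kev (U 1 k 0 \<nu>)\<close> is tested with the initial data; splitting off the value
        \<open>kev (u0 k \<nu>)\<close> of the data leaves the initial energy and the jump.\<close>
      finally show ?thesis
        using kev_inner_self[OF dens0_pos[OF k \<nu>]] by (simp add: inner_diff_left)
    qed
    have "(\<Sum>n=1..KT. AT n k) = (\<Sum>n=1..KT. \<Sum>\<nu>\<in>nodes N. wt N \<nu> * jac N (chart \<M> k) \<nu> *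
        (\<phi> n k M \<nu> \<bullet> Ustar n k \<nu> - \<phi> n k 0 \<nu> \<bullet> Ustar (n - 1) k \<nu>))"
      by (intro sum.cong refl AT)
    also have "\<dots> = (\<Sum>\<nu>\<in>nodes N. wt N \<nu> * jac N (chart \<M> k) \<nu> *
        (\<Sum>n=1..KT. \<phi> n k M \<nu> \<bullet> Ustar n k \<nu> - \<phi> n k 0 \<nu> \<bullet> Ustar (n - 1) k \<nu>))"
      unfolding sum_distrib_left by (rule sum.swap)
    finally show ?thesis by (simp only: point cong: sum.cong)
  qed

  have space: "(\<Sum>k=1..?K. AS n k) = - (dt n / 2 * ((\<Sum>k=1..?K. Div n k) + Work n))"
    if n: "n \<in> {1..KT}" for n
  proof -
    have "(\<Sum>k=1..?K. AS n k) = (\<Sum>k=1..?K. dt n / 2 * (\<Sum>f\<in>UNIV. face_integral N M f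
        (\<lambda>\<sigma> \<nu>. \<phi> n k \<sigma> \<nu> \<bullet> surface_flux N \<M> FS (U n) k f \<sigma> \<nu>)) - dt n / 2 * Div n k)"
      unfolding AS_def Div_def \<phi>_def[abs_def]
      by (intro sum.cong refl A_S_kev[OF degrees(1) volume] dens_pos[OF n])
    also have "\<dots> = dt n / 2 * (\<Sum>k=1..?K. \<Sum>f\<in>UNIV. face_integral N M f
        (\<lambda>\<sigma> \<nu>. \<phi> n k \<sigma> \<nu> \<bullet> surface_flux N \<M> FS (U n) k f \<sigma> \<nu>)) - dt n / 2 * (\<Sum>k=1..?K. Div n k)"
      by (simp add: sum_subtractf sum_distrib_left)
    also have "(\<Sum>k=1..?K. \<Sum>f\<in>UNIV. face_integral N M f
        (\<lambda>\<sigma> \<nu>. \<phi> n k \<sigma> \<nu> \<bullet> surface_flux N \<M> FS (U n) k f \<sigma> \<nu>)) = - Work n"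
      unfolding \<phi>_def Work_def
      by (rule sum_surface_flux_kev[OF surface degrees(1) mesh dens_pos[OF n]])
    finally show ?thesis by (simp add: algebra_simps)
  qed

  have "(\<Sum>k=1..?K. \<Sum>n=1..KT. AT n k) + (\<Sum>n=1..KT. \<Sum>k=1..?K. AS n k) = 0"
    by (subst sum.swap) (simp add: sum.distrib[symmetric] balance)
  moreover have "(\<Sum>k=1..?K. \<Sum>n=1..KT. AT n k) = total_kin N \<M> (\<lambda>k. U KT k M) - total_kin N \<M> u0
      - (\<Sum>k=1..?K. ip_space N (\<lambda>\<nu>. (kev (U 1 k 0 \<nu>) - kev (u0 k \<nu>)) \<bullet> u0 k \<nu>) (jac N (chart \<M> k)))"
    by (simp add: time total_kin_def ip_space_def sum_subtractf[symmetric] del: One_nat_def)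
       (simp add: right_diff_distrib mult_ac)
  moreover have "(\<Sum>n=1..KT. \<Sum>k=1..?K. AS n k)
      = - (\<Sum>n=1..KT. \<Sum>k=1..?K. dt n / 2 * Div n k) - (\<Sum>n=1..KT. dt n / 2 * Work n)"
    by (subst sum.cong[OF refl space], assumption)
       (simp add: sum_negf sum_subtractf distrib_left sum.distrib sum_distrib_left)
  ultimately show ?thesis
    by (simp add: Div_def Work_def sum_distrib_left)
qed

end
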